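(* Let $n\in\{2,3\}$, let $\mathcal{B}\subset\mathbb{R}^n$ be the reference configuration of an elastic body, and let $Z=[H^{1}(\mathcal{B})]^{n}\times H^{\mathbf{c}}(\mathcal{B})\times H^{\mathbf{d}}(\mathcal{B})$. Let $O\subset H^{\mathbf{c}}(\mathcal{B})$ be a nonempty open set on which the response function defines a Fréchet differentiable map $\mathbb{P}:O\to[L^2(\mathcal{B})]^{n\times n}$, with derivative $\mathrm{D}\mathbb{P}(\boldsymbol{K})\boldsymbol{M}=\mathsf{A}(\boldsymbol{K}):\boldsymbol{M}$ (the material may be hyperelastic or not). For $u=(\boldsymbol{U},\boldsymbol{K},\boldsymbol{P})\in Z$ with $\boldsymbol{K}\in O$ and $v=(\boldsymbol{\Upsilon},\boldsymbol{\lambda},\boldsymbol{\pi})\in Z$ put $$G(u,v)=\langle\boldsymbol{P},\mathbf{grad}\,\boldsymbol{\Upsilon}\rangle+\langle\mathbf{grad}\,\boldsymbol{U},\boldsymbol{\lambda}\rangle-\langle\boldsymbol{K},\boldsymbol{\lambda}\rangle+\langle\mathbb{P}(\boldsymbol{K}),\boldsymbol{\pi}\rangle-\langle\boldsymbol{P},\boldsymbol{\pi}\rangle-\langle\boldsymbol{B},\boldsymbol{\Upsilon}\rangle-\int_{\Gamma_2}\overline{\boldsymbol{T}}\cdot\boldsymbol{\Upsilon}\,dA .$$ Then the problem "find $u$ such that $G(u,v)=0$ for all $v\in Z$" is not the stationarity condition of any functional on $Z$: there is no functional $J:Z\to\mathbb{R}$, Fréchet differentiable at every $u=(\boldsymbol{U},\boldsymbol{K},\boldsymbol{P})\in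 Z$ with $\boldsymbol{K}\in O$, such that $\mathrm{D}J(u)v=G(u,v)$ for all such $u$ and all $v\in Z$.
   Context: $\mathcal{B}\subset\mathbb{R}^n$ is a (nonempty, bounded, sufficiently regular) domain whose boundary is $\partial\mathcal{B}=\Gamma_1\cup\Gamma_2$, where $\Gamma_1,\Gamma_2$ have disjoint interiors. $\langle\cdot,\cdot\rangle$ denotes the $L^2$-inner product both of vector fields, $\int_{\mathcal{B}}Y^IZ^I\,dV$, and of second-order tensor fields, $\int_{\mathcal{B}}S^{IJ}T^{IJ}\,dV$ (summation over repeated indices). In Cartesian components, $(\mathbf{grad}\,\boldsymbol{U})^{IJ}=\partial_JU^I$, $(\mathbf{div}\,\boldsymbol{T})^I=\partial_JT^{IJ}$, and $(\mathbf{curl}\,\boldsymbol{T})^{IJ}=\varepsilon_{JKL}\partial_KT^{IL}$ if $n=3$, while $(\mathbf{curl}\,\boldsymbol{T})^I=\partial_1T^{I2}-\partial_2T^{I1}$ if $n=2$. $[H^1(\mathcal{B})]^n$ is the space of $H^1$ vector fields; $H^{\mathbf{c}}(\mathcal{B})$ (resp. $H^{\mathbf{d}}(\mathcal{B})$) is the space of $L^2$ second-order tensor fields with $L^2$ $\mathbf{curl}$ (resp. $L^2$ $\mathbf{div}$). These carry the graph norms $\|\boldsymbol{V}\|_1^2=\langle\boldsymbol{V},\boldsymbol{V}\rangle+\langle\mathbf{grad}\,\boldsymbol{V},\mathbf{grad}\,\boldsymbol{V}\rangle$, $\|\boldsymbol{M}\|_{\mathbf{c}}^2=\langle\boldsymbol{M},\boldsymbol{M}\rangle+\langle\mathbf{curl}\,\boldsymbol{M},\mathbf{curl}\,\boldsymbol{M}\rangle$,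 $\|\boldsymbol{Q}\|_{\mathbf{d}}^2=\langle\boldsymbol{Q},\boldsymbol{Q}\rangle+\langle\mathbf{div}\,\boldsymbol{Q},\mathbf{div}\,\boldsymbol{Q}\rangle$, and $Z$ carries the product norm. $\boldsymbol{U}$, $\boldsymbol{K}$, $\boldsymbol{P}$ represent displacement, displacement gradient and first Piola-Kirchhoff stress; $\boldsymbol{P}=\mathbb{P}(\boldsymbol{K})$ is the constitutive equation; $\mathsf{A}(\boldsymbol{K})$ is the elasticity tensor in terms of the displacement gradient, with $(\mathsf{A}(\boldsymbol{K}):\boldsymbol{M})^{IJ}=A^{IJRS}M^{RS}$. The body force $\boldsymbol{B}$ and the boundary traction $\overline{\boldsymbol{T}}$ on $\Gamma_2$ are given $L^2$ vector fields. $\mathrm{D}J(u)v$ is the Fréchet derivative of $J$ at $u$ in the direction $v$. *)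

theory Defs
  imports "HOL-Analysis.Analysis" "HOL-Library.Function_Algebras"
begin

section \<open>Linear structure on fields\<close>

text \<open>
  Fields on a region of \<open>\<real>\<^sup>n\<close> are total functions on \<open>\<real>\<^sup>n\<close>; only their values on the region
  (up to null sets) ever matter.  Function spaces are linear sets of such representatives
  with their seminorm; functionals are required to respect equality almost everywhere.
\<close>

instantiation "fun" :: (type, real_vector) real_vector
begin

definition scaleR_fun :: "real \<Rightarrow> ('a \<Rightarrow> 'b) \<Rightarrow> 'a \<Rightarrow> 'b"
  where "scaleR_fun c f = (\<lambda>x. c *\<^sub>R f x)"

instance
  by standard (auto simp: scaleR_fun_def fun_eq_iff algebra_simps)

end

type_synonym 'n vfield = "real^'n \<Rightarrow> real^'n"
type_synonym 'n tfield = "real^'n \<Rightarrow> real^'n^'n"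

text \<open>
  The components \<open>T\<^sup>I\<^sup>J\<close> of a second-order tensor are \<open>T $ I $ J\<close>.  The inner product of
  \<open>real^'n^'n\<close> is therefore \<open>S\<^sup>I\<^sup>J T\<^sup>I\<^sup>J\<close> and its norm the Frobenius norm.
\<close>

section \<open>Square-integrable fields\<close>

definition L2 :: "'a measure \<Rightarrow> ('a \<Rightarrow> 'b::euclidean_space) set" where
  "L2 M = {f \<in> borel_measurable M. integrable M (\<lambda>x. (norm (f x))\<^sup>2)}"

definition L2_inner :: "'a measure \<Rightarrow> ('a \<Rightarrow> 'b::euclidean_space) \<Rightarrow> ('a \<Rightarrow> 'b) \<Rightarrow> real" where
  "L2_inner M f g = (\<integral>x. f x \<bullet> g x \<partial>M)"

definition L2_norm :: "'a measure \<Rightarrow> ('a \<Rightarrow> 'b::euclidean_space) \<Rightarrow> real" where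
  "L2_norm M f = sqrt (L2_inner M f f)"

section \<open>Test functions and weak derivatives\<close>

primrec Ck :: "nat \<Rightarrow> ('a::euclidean_space \<Rightarrow> 'b::real_normed_vector) \<Rightarrow> bool" where
  "Ck 0 f \<longleftrightarrow> continuous_on UNIV f"
| "Ck (Suc k) f \<longleftrightarrow> (\<forall>x. f differentiable (at x)) \<and>
     (\<forall>b\<in>Basis. Ck k (\<lambda>x. frechet_derivative f (at x) b))"

definition smooth :: "('a::euclidean_space \<Rightarrow> 'b::real_normed_vector) \<Rightarrow> bool" where
  "smooth f \<longleftrightarrow> (\<forall>k. Ck k f)"

definition test_fun :: "(real^'n) set \<Rightarrow> (real^'n \<Rightarrow> real) \<Rightarrow> bool" where
  "test_fun B \<phi> \<longleftrightarrow> smooth \<phi> \<and>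
     compact (closure {x. \<phi> x \<noteq> 0}) \<and> closure {x. \<phi> x \<noteq> 0} \<subseteq> B"

definition pd :: "'n \<Rightarrow> (real^'n \<Rightarrow> real) \<Rightarrow> real^'n \<Rightarrow> real" where
  "pd I \<phi> x = frechet_derivative \<phi> (at x) (axis I 1)"

definition is_weak_grad :: "(real^'n) set \<Rightarrow> 'n vfield \<Rightarrow> 'n tfield \<Rightarrow> bool" where
  "is_weak_grad B U G \<longleftrightarrow> (\<forall>\<phi> I J. test_fun B \<phi> \<longrightarrow>
     (\<integral>x. G x $ I $ J * \<phi> x \<partial>lebesgue_on B) = - (\<integral>x. U x $ I * pd J \<phi> x \<partial>lebesgue_on B))"

definition is_weak_div :: "(real^'n) set \<Rightarrow> 'n tfield \<Rightarrow> 'n vfield \<Rightarrow> bool" where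
  "is_weak_div B T D \<longleftrightarrow> (\<forall>\<phi> I. test_fun B \<phi> \<longrightarrow>
     (\<integral>x. D x $ I * \<phi> x \<partial>lebesgue_on B)
       = - (\<integral>x. (\<Sum>J\<in>UNIV. T x $ I $ J * pd J \<phi> x) \<partial>lebesgue_on B))"

text \<open>
  The index type \<open>'n\<close> carries no preferred ordering, so the \<open>curl\<close>s refer to a numbering
  \<open>ix\<close> of the Cartesian coordinates: \<open>ix i\<close> is the \<open>i\<close>-th coordinate, \<open>1 \<le> i \<le> n\<close>.
\<close>

text \<open>The permutation symbol, for arguments in \<open>{1, 2, 3}\<close>.\<close>
definition levi_civita :: "nat \<Rightarrow> nat \<Rightarrow> nat \<Rightarrow> real" where
  "levi_civita j k l = (real k - real j) * (real l - real j) * (real l - real k) / 2"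

definition is_weak_curl2 :: "(nat \<Rightarrow> 'n) \<Rightarrow> (real^'n) set \<Rightarrow> 'n tfield \<Rightarrow> 'n vfield \<Rightarrow> bool" where
  "is_weak_curl2 ix B T C \<longleftrightarrow> (\<forall>\<phi> I. test_fun B \<phi> \<longrightarrow>
     (\<integral>x. C x $ I * \<phi> x \<partial>lebesgue_on B)
       = - (\<integral>x. T x $ I $ ix 2 * pd (ix 1) \<phi> x - T x $ I $ ix 1 * pd (ix 2) \<phi> x \<partial>lebesgue_on B))"

definition is_weak_curl3 :: "(nat \<Rightarrow> 'n) \<Rightarrow> (real^'n) set \<Rightarrow> 'n tfield \<Rightarrow> 'n tfield \<Rightarrow> bool" where
  "is_weak_curl3 ix B T C \<longleftrightarrow> (\<forall>\<phi> I. \<forall>j\<in>{1..3}. test_fun B \<phi> \<longrightarrow>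
     (\<integral>x. C x $ I $ ix j * \<phi> x \<partial>lebesgue_on B)
       = - (\<integral>x. (\<Sum>k=1..3. \<Sum>l=1..3.
               levi_civita j k l * T x $ I $ ix l * pd (ix k) \<phi> x) \<partial>lebesgue_on B))"

text \<open>
  Weak derivatives are unique only almost everywhere; an arbitrary square-integrable
  representative is chosen.
\<close>

definition wgrad :: "(real^'n) set \<Rightarrow> 'n vfield \<Rightarrow> 'n tfield" where
  "wgrad B U = (SOME G. G \<in> L2 (lebesgue_on B) \<and> is_weak_grad B U G)"

definition wdiv :: "(real^'n) set \<Rightarrow> 'n tfield \<Rightarrow> 'n vfield" where
  "wdiv B T = (SOME D. D \<in> L2 (lebesgue_on B) \<and> is_weak_div B T D)"

definition wcurl2 :: "(nat \<Rightarrow> 'n) \<Rightarrow> (real^'n) set \<Rightarrow> 'n tfield \<Rightarrow> 'n vfield" where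
  "wcurl2 ix B T = (SOME C. C \<in> L2 (lebesgue_on B) \<and> is_weak_curl2 ix B T C)"

definition wcurl3 :: "(nat \<Rightarrow> 'n) \<Rightarrow> (real^'n) set \<Rightarrow> 'n tfield \<Rightarrow> 'n tfield" where
  "wcurl3 ix B T = (SOME C. C \<in> L2 (lebesgue_on B) \<and> is_weak_curl3 ix B T C)"

section \<open>The spaces \<open>H\<^sup>1\<close>, \<open>H\<^sup>c\<close>, \<open>H\<^sup>d\<close> and their product\<close>

definition H1 :: "(real^'n) set \<Rightarrow> 'n vfield set" where
  "H1 B = {U \<in> L2 (lebesgue_on B). \<exists>G \<in> L2 (lebesgue_on B). is_weak_grad B U G}"

definition H1_norm :: "(real^'n) set \<Rightarrow> 'n vfield \<Rightarrow> real" where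
  "H1_norm B V = sqrt (L2_inner (lebesgue_on B) V V
     + L2_inner (lebesgue_on B) (wgrad B V) (wgrad B V))"

definition Hc :: "(nat \<Rightarrow> 'n) \<Rightarrow> (real^'n) set \<Rightarrow> 'n tfield set" where
  "Hc ix B = {M \<in> L2 (lebesgue_on B).
     if CARD('n) = 2 then \<exists>C \<in> L2 (lebesgue_on B). is_weak_curl2 ix B M C
     else \<exists>C \<in> L2 (lebesgue_on B). is_weak_curl3 ix B M C}"

definition Hc_norm :: "(nat \<Rightarrow> 'n) \<Rightarrow> (real^'n) set \<Rightarrow> 'n tfield \<Rightarrow> real" where
  "Hc_norm ix B M = sqrt (L2_inner (lebesgue_on B) M M +
     (if CARD('n) = 2 then L2_inner (lebesgue_on B) (wcurl2 ix B M) (wcurl2 ix B M)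
      else L2_inner (lebesgue_on B) (wcurl3 ix B M) (wcurl3 ix B M)))"

definition Hd :: "(real^'n) set \<Rightarrow> 'n tfield set" where
  "Hd B = {Q \<in> L2 (lebesgue_on B). \<exists>D \<in> L2 (lebesgue_on B). is_weak_div B Q D}"

definition Hd_norm :: "(real^'n) set \<Rightarrow> 'n tfield \<Rightarrow> real" where
  "Hd_norm B Q = sqrt (L2_inner (lebesgue_on B) Q Q
     + L2_inner (lebesgue_on B) (wdiv B Q) (wdiv B Q))"

type_synonym 'n state = "'n vfield \<times> 'n tfield \<times> 'n tfield"

definition Z_space :: "(nat \<Rightarrow> 'n) \<Rightarrow> (real^'n) set \<Rightarrow> 'n state set" where
  "Z_space ix B = H1 B \<times> Hc ix B \<times> Hd B"

definition Z_norm :: "(nat \<Rightarrow> 'n) \<Rightarrow> (real^'n) set \<Rightarrow> 'n state \<Rightarrow> real" where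
  "Z_norm ix B = (\<lambda>(U, K, P). sqrt ((H1_norm B U)\<^sup>2 + (Hc_norm ix B K)\<^sup>2 + (Hd_norm B P)\<^sup>2))"

definition ae_eq :: "'a measure \<Rightarrow> ('a \<Rightarrow> 'b) \<Rightarrow> ('a \<Rightarrow> 'b) \<Rightarrow> bool" where
  "ae_eq M f g \<longleftrightarrow> (AE x in M. f x = g x)"

definition Z_functional :: "(nat \<Rightarrow> 'n) \<Rightarrow> (real^'n) set \<Rightarrow> ('n state \<Rightarrow> real) \<Rightarrow> bool" where
  "Z_functional ix B J \<longleftrightarrow> (\<forall>U K P U' K' P'.
     (U, K, P) \<in> Z_space ix B \<and> (U', K', P') \<in> Z_space ix B \<and>
     ae_eq (lebesgue_on B) U U' \<and> ae_eq (lebesgue_on B) K K' \<and> ae_eq (lebesgue_on B) P P'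
     \<longrightarrow> J (U, K, P) = J (U', K', P'))"

section \<open>Open sets and Frechet derivatives in seminormed function spaces\<close>

definition seminorm_open :: "'v::real_vector set \<Rightarrow> ('v \<Rightarrow> real) \<Rightarrow> 'v set \<Rightarrow> bool" where
  "seminorm_open V nV S \<longleftrightarrow> S \<subseteq> V \<and> (\<forall>u\<in>S. \<exists>\<epsilon>>0. \<forall>v\<in>V. nV (v - u) < \<epsilon> \<longrightarrow> v \<in> S)"

text \<open>
  \<open>D\<close> is the derivative at \<open>u\<close> of \<open>f\<close>, which maps a neighbourhood of \<open>u\<close> in \<open>(V, nV)\<close> to
  \<open>(W, nW)\<close>: it is a bounded linear map (linear up to \<open>nW\<close>-null vectors, i.e. on
  equivalence classes) and the remainder is \<open>o(nV h)\<close>.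
\<close>
definition has_frechet_deriv ::
  "'v::real_vector set \<Rightarrow> ('v \<Rightarrow> real) \<Rightarrow> 'w::real_vector set \<Rightarrow> ('w \<Rightarrow> real)
    \<Rightarrow> ('v \<Rightarrow> 'w) \<Rightarrow> ('v \<Rightarrow> 'w) \<Rightarrow> 'v \<Rightarrow> bool" where
  "has_frechet_deriv V nV W nW f D u \<longleftrightarrow>
     (\<forall>h\<in>V. D h \<in> W) \<and>
     (\<forall>h\<in>V. \<forall>k\<in>V. \<forall>a b. nW (D (a *\<^sub>R h + b *\<^sub>R k) - (a *\<^sub>R D h + b *\<^sub>R D k)) = 0) \<and>
     (\<exists>C. \<forall>h\<in>V. nW (D h) \<le> C * nV h) \<and>
     (\<forall>\<epsilon>>0. \<exists>\<delta>>0. \<forall>h\<in>V. nV h < \<delta> \<longrightarrow>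
        f (u + h) \<in> W \<and> nW (f (u + h) - f u - D h) \<le> \<epsilon> * nV h)"

section \<open>Lipschitz domains, surface measure and traces\<close>

text \<open>Locally, up to a rotation, the domain is the strict subgraph of a Lipschitz function
  of the coordinates orthogonal to \<open>\<nu>\<close>.\<close>
definition lipschitz_domain :: "'a::euclidean_space set \<Rightarrow> bool" where
  "lipschitz_domain B \<longleftrightarrow> open B \<and> connected B \<and> bounded B \<and> B \<noteq> {} \<and>
     (\<forall>x\<in>frontier B. \<exists>r>0. \<exists>\<nu> g L. norm \<nu> = 1 \<and> L-lipschitz_on UNIV (g :: 'a \<Rightarrow> real) \<and>
        B \<inter> ball x r = {y \<in> ball x r. y \<bullet> \<nu> < g (y - (y \<bullet> \<nu>) *\<^sub>R \<nu>)})"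

text \<open>
  The \<open>(n-1)\<close>-dimensional Hausdorff measure on \<open>\<real>\<^sup>n\<close>, normalised so that it agrees with
  Lebesgue measure on hyperplanes, on its Caratheodory-measurable sets.  Boundedness of the
  covering sets is stated because \<open>diameter\<close> is unspecified on unbounded sets.
\<close>

definition surface_premeasure :: "real \<Rightarrow> (real^'n) set \<Rightarrow> ennreal" where
  "surface_premeasure \<delta> A =
     (INF C \<in> {C :: nat \<Rightarrow> (real^'n) set. A \<subseteq> (\<Union>i. C i) \<and>
                 (\<forall>i. bounded (C i) \<and> diameter (C i) \<le> \<delta>)}.
        \<Sum>i. ennreal (unit_ball_vol (real (CARD('n) - 1)) * (diameter (C i) / 2) ^ (CARD('n) - 1)))"

definition surface_outer_measure :: "(real^'n) set \<Rightarrow> ennreal" where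
  "surface_outer_measure A = (SUP \<delta>\<in>{0<..}. surface_premeasure \<delta> A)"

definition surface_measure :: "(real^'n) measure" where
  "surface_measure =
     measure_of UNIV (lambda_system UNIV UNIV surface_outer_measure) surface_outer_measure"

lemma surface_premeasure_mono: "A \<subseteq> A' \<Longrightarrow> surface_premeasure \<delta> A \<le> surface_premeasure \<delta> A'"
  unfolding surface_premeasure_def by (rule INF_superset_mono) auto

lemma surface_premeasure_subadditive:
  assumes "\<delta> > 0"
  shows "surface_premeasure \<delta> (\<Union>i. A i :: (real^'n) set) \<le> (\<Sum>i. surface_premeasure \<delta> (A i))"
proof -
  define w :: "(real^'n) set \<Rightarrow> ennreal" where
    "w S = ennreal (unit_ball_vol (real (CARD('n) - 1)) * (diameter S / 2) ^ (CARD('n) - 1))" for S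
  define \<C> :: "(real^'n) set \<Rightarrow> (nat \<Rightarrow> (real^'n) set) set" where
    "\<C> S = {C. S \<subseteq> (\<Union>i. C i) \<and> (\<forall>i. bounded (C i) \<and> diameter (C i) \<le> \<delta>)}" for S
  have pre: "surface_premeasure \<delta> S = (INF C\<in>\<C> S. \<Sum>i. w (C i))" for S
    by (simp add: surface_premeasure_def w_def \<C>_def)
  show ?thesis
  proof (rule ennreal_le_epsilon)
    fix e :: real
    assume e: "0 < e" and fin: "(\<Sum>i. surface_premeasure \<delta> (A i)) < top"
    have fin': "surface_premeasure \<delta> (A i) < top" for i
      using fin by (metis ennreal_suminf_lessD)
    have "\<exists>C\<in>\<C> (A i). (\<Sum>j. w (C j)) < surface_premeasure \<delta> (A i) + ennreal (e * (1/2) ^ Suc i)" for i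
    proof -
      have "0 < ennreal (e * (1/2) ^ Suc i)"
        using e by (simp add: ennreal_zero_less_mult_iff)
      then have "surface_premeasure \<delta> (A i) < surface_premeasure \<delta> (A i) + ennreal (e * (1/2) ^ Suc i)"
        using fin'[of i] ennreal_add_left_cancel_less[of "surface_premeasure \<delta> (A i)" 0]
        by (simp only: add_0_right) auto
      then have "(INF C\<in>\<C> (A i). \<Sum>j. w (C j)) < surface_premeasure \<delta> (A i) + ennreal (e * (1/2) ^ Suc i)"
        by (simp only: pre)
      then show ?thesis by (simp only: INF_less_iff)
    qed
    then obtain C where C: "\<And>i. C i \<in> \<C> (A i)"
      and Cle: "\<And>i. (\<Sum>j. w (C i j)) < surface_premeasure \<delta> (A i) + ennreal (e * (1/2) ^ Suc i)"
      by metis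
    define E where "E = (\<lambda>m. case prod_decode m of (i, j) \<Rightarrow> C i j)"
    have "E \<in> \<C> (\<Union>i. A i)"
    proof -
      have "(\<Union>i. A i) \<subseteq> (\<Union>m. E m)"
      proof
        fix x assume "x \<in> (\<Union>i. A i)"
        then obtain i where "x \<in> A i" by auto
        with C[of i] obtain j where "x \<in> C i j" unfolding \<C>_def by auto
        then have "x \<in> E (prod_encode (i, j))" by (simp add: E_def)
        then show "x \<in> (\<Union>m. E m)" by blast
      qed
      moreover have "bounded (E m) \<and> diameter (E m) \<le> \<delta>" for m
        using C unfolding E_def \<C>_def by (auto split: prod.split)
      ultimately show ?thesis by (simp add: \<C>_def)
    qed
    then have "surface_premeasure \<delta> (\<Union>i. A i) \<le> (\<Sum>m. w (E m))"
      unfolding pre by (rule INF_lower)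
    also have "(\<Sum>m. w (E m)) = (\<Sum>i. \<Sum>j. w (C i j))"
      using suminf_ennreal_2dimen[of "\<lambda>i. \<Sum>j. w (C i j)" "\<lambda>(i, j). w (C i j)"]
      by (simp add: E_def comp_def case_prod_beta)
    also have "\<dots> \<le> (\<Sum>i. surface_premeasure \<delta> (A i) + ennreal (e * (1/2) ^ Suc i))"
      using Cle by (intro suminf_le) (auto intro: less_imp_le)
    also have "\<dots> = (\<Sum>i. surface_premeasure \<delta> (A i)) + (\<Sum>i. ennreal (e * (1/2) ^ Suc i))"
      by (intro suminf_add[symmetric]) auto
    also have "(\<Sum>i. ennreal (e * (1/2) ^ Suc i)) = ennreal e"
    proof -
      have "(\<lambda>i. e * (1/2) ^ Suc i) sums (e * 1)"
        by (intro sums_mult power_half_series)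
      then show ?thesis
        using e by (intro suminf_ennreal_eq) auto
    qed
    finally show "surface_premeasure \<delta> (\<Union>i. A i) \<le> (\<Sum>i. surface_premeasure \<delta> (A i)) + ennreal e" .
  qed
qed

lemma surface_outer_measure_space:
  assumes "CARD('n) \<ge> 2"
  shows "outer_measure_space UNIV (surface_outer_measure :: (real^'n) set \<Rightarrow> ennreal)"
  unfolding outer_measure_space_def
proof (intro conjI)
  have "surface_premeasure \<delta> ({} :: (real^'n) set) = 0" if "\<delta> > 0" for \<delta>
  proof -
    have "surface_premeasure \<delta> ({} :: (real^'n) set) \<le> (\<Sum>i::nat. 0)"
      unfolding surface_premeasure_def
      using assms that by (intro INF_lower2[of "\<lambda>_. {}"]) (auto simp: power_0_left)
    then show ?thesis by simp
  qed
  then show "positive UNIV (surface_outer_measure :: (real^'n) set \<Rightarrow> ennreal)"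
    by (auto simp: positive_def surface_outer_measure_def intro!: SUP_eq_const)
  show "increasing UNIV (surface_outer_measure :: (real^'n) set \<Rightarrow> ennreal)"
    by (auto simp: increasing_def surface_outer_measure_def intro!: SUP_mono' surface_premeasure_mono)
  show "countably_subadditive UNIV (surface_outer_measure :: (real^'n) set \<Rightarrow> ennreal)"
    unfolding countably_subadditive_def surface_outer_measure_def
  proof (intro allI impI SUP_least)
    fix A :: "nat \<Rightarrow> (real^'n) set" and \<delta> :: real
    assume "\<delta> \<in> {0<..}"
    then have "surface_premeasure \<delta> (\<Union>i. A i) \<le> (\<Sum>i. surface_premeasure \<delta> (A i))"
      by (intro surface_premeasure_subadditive) auto
    also have "\<dots> \<le> (\<Sum>i. SUP \<delta>\<in>{0<..}. surface_premeasure \<delta> (A i))"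
      using \<open>\<delta> \<in> {0<..}\<close> by (intro suminf_le SUP_upper) auto
    finally show "surface_premeasure \<delta> (\<Union>i. A i) \<le> (\<Sum>i. SUP \<delta>\<in>{0<..}. surface_premeasure \<delta> (A i))" .
  qed
qed

lemma surface_measure:
  assumes "CARD('n) \<ge> 2"
  shows sets_surface_measure: "sets (surface_measure :: (real^'n) measure)
           = lambda_system UNIV UNIV surface_outer_measure"
    and emeasure_surface_measure: "A \<in> sets (surface_measure :: (real^'n) measure)
           \<Longrightarrow> emeasure surface_measure A = surface_outer_measure A"
proof -
  let ?L = "lambda_system UNIV UNIV (surface_outer_measure :: (real^'n) set \<Rightarrow> ennreal)"
  have m: "measure_space UNIV ?L surface_outer_measure"
    using sigma_algebra.caratheodory_lemma[OF sigma_algebra_Pow, of UNIV]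
      surface_outer_measure_space[OF assms] by simp
  then have s: "sigma_algebra UNIV ?L" by (simp add: measure_space_def)
  have eq: "sigma_sets UNIV ?L = ?L"
    by (rule sigma_algebra.sigma_sets_eq[OF s])
  show 1: "sets (surface_measure :: (real^'n) measure) = ?L"
    by (simp add: surface_measure_def eq)
  show "emeasure surface_measure A = surface_outer_measure A"
    if "A \<in> sets (surface_measure :: (real^'n) measure)"
    using that m s unfolding 1 unfolding surface_measure_def
    by (intro emeasure_measure_of_sigma) (auto simp: measure_space_def)
qed

definition surface_on :: "(real^'n) set \<Rightarrow> (real^'n) measure" where
  "surface_on S = restrict_space surface_measure S"

text \<open>
  The trace on the boundary is the limit in \<open>L\<^sup>2\<close> of the restrictions of smooth fields
  approximating the given field in \<open>H\<^sup>1\<close>.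
\<close>

definition is_trace :: "(real^'n) set \<Rightarrow> 'n vfield \<Rightarrow> 'n vfield \<Rightarrow> bool" where
  "is_trace B V \<tau> \<longleftrightarrow> \<tau> \<in> L2 (surface_on (frontier B)) \<and>
     (\<exists>\<Phi> :: nat \<Rightarrow> 'n vfield. (\<forall>m. smooth (\<Phi> m)) \<and>
        (\<lambda>m. H1_norm B (\<Phi> m - V)) \<longlonglongrightarrow> 0 \<and>
        (\<lambda>m. L2_norm (surface_on (frontier B)) (\<Phi> m - \<tau>)) \<longlonglongrightarrow> 0)"

definition trace_of :: "(real^'n) set \<Rightarrow> 'n vfield \<Rightarrow> 'n vfield" where
  "trace_of B V = (SOME \<tau>. is_trace B V \<tau>)"

section \<open>Elasticity\<close>

text \<open>The field \<open>X \<mapsto> R(X, K(X))\<close> given by a constitutive response function \<open>R\<close>.\<close>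
definition response :: "(real^'n \<Rightarrow> real^'n^'n \<Rightarrow> real^'n^'n) \<Rightarrow> 'n tfield \<Rightarrow> 'n tfield" where
  "response R K = (\<lambda>X. R X (K X))"

definition ddot :: "real^'n^'n^'n^'n \<Rightarrow> real^'n^'n \<Rightarrow> real^'n^'n" where
  "ddot A M = (\<chi> I J. \<Sum>R\<in>UNIV. \<Sum>S\<in>UNIV. A $ I $ J $ R $ S * M $ R $ S)"

definition G_form ::
  "(real^'n) set \<Rightarrow> (real^'n) set \<Rightarrow> (real^'n \<Rightarrow> real^'n^'n \<Rightarrow> real^'n^'n)
    \<Rightarrow> 'n vfield \<Rightarrow> 'n vfield \<Rightarrow> 'n state \<Rightarrow> 'n state \<Rightarrow> real" where
  "G_form B \<Gamma>\<^sub>2 R bf Tbar = (\<lambda>(U, K, P) (\<Upsilon>, \<Lambda>, \<pi>).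
      L2_inner (lebesgue_on B) P (wgrad B \<Upsilon>)
    + L2_inner (lebesgue_on B) (wgrad B U) \<Lambda>
    - L2_inner (lebesgue_on B) K \<Lambda>
    + L2_inner (lebesgue_on B) (response R K) \<pi>
    - L2_inner (lebesgue_on B) P \<pi>
    - L2_inner (lebesgue_on B) bf \<Upsilon>
    - L2_inner (surface_on \<Gamma>\<^sub>2) Tbar (trace_of B \<Upsilon>))"

end

theory Submission
  imports Defs "HOL-Real_Asymp.Real_Asymp"
begin

text \<open>
  A differentiable \<open>J\<close> with \<open>DJ(u)v = G(u,v)\<close> would have equal mixed derivatives in \<open>U\<close> and \<open>K\<close>,
  but \<open>G\<close> contains \<open>\<langle>grad U, \<lambda>\<rangle>\<close> without a counterpart \<open>\<langle>K, grad \<Upsilon>\<rangle>\<close>.  Concretely, let \<open>X\<close> be the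
  identity vector field, \<open>E = grad X\<close> the constant unit tensor, \<open>K\<^sub>0 \<in> \<O>\<close> and
  \<open>j(s,t) = J(s X, K\<^sub>0 + t E, 0)\<close>.  Then \<open>\<partial>\<^sub>s j\<close> is constant, so \<open>j(1,t) - j(0,t)\<close> does not depend
  on small \<open>t\<close>, whereas its \<open>t\<close>-derivative at \<open>0\<close> is \<open>\<langle>grad X, E\<rangle> = n vol(B) > 0\<close>.  Weak derivatives
  being arbitrary representatives, the fundamental lemma of the calculus of variations is
  needed to compute \<open>\<langle>grad X, E\<rangle>\<close> and the norms of multiples of \<open>X\<close> and \<open>E\<close>.
\<close>

section \<open>Smooth bump functions\<close>

lemma Ck_const: "Ck k (\<lambda>x. c)"
  by (induction k arbitrary: c) auto

text \<open>\<open>Ck (Suc k)\<close> does not list \<open>Ck k\<close> of \<open>f\<close> itself.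
  At the bottom level differentiability supplies continuity; above it the induction hypothesis
  applies to every directional derivative.\<close>

lemma Ck_SucD: "Ck (Suc k) f \<Longrightarrow> Ck k f"
proof (induction k arbitrary: f)
  case 0
  then show ?case
    by (auto simp: continuous_on_eq_continuous_at differentiable_imp_continuous_within)
next
  case (Suc k)
  from Suc.prems have "\<forall>x. f differentiable (at x)"
    and "\<forall>b\<in>Basis. Ck (Suc k) (\<lambda>x. frechet_derivative f (at x) b)"
    by (subst (asm) Ck.simps(2), blast)+
  then show ?case
    using Suc.IH by (subst Ck.simps(2)) blast
qed

lemma frechet_derivative_add_at:
  assumes "f differentiable (at x)" "g differentiable (at x)"
  shows "frechet_derivative (\<lambda>x. f x + g x) (at x)
    = (\<lambda>b. frechet_derivative f (at x) b + frechet_derivative g (at x) b)"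
  using assms[unfolded frechet_derivative_works]
  by (intro frechet_derivative_at[symmetric] has_derivative_add)

lemma frechet_derivative_mult_at:
  fixes f g :: "'a::real_normed_vector \<Rightarrow> real"
  assumes "f differentiable (at x)" "g differentiable (at x)"
  shows "frechet_derivative (\<lambda>x. f x * g x) (at x)
    = (\<lambda>b. f x * frechet_derivative g (at x) b + frechet_derivative f (at x) b * g x)"
  using assms[unfolded frechet_derivative_works]
  by (intro frechet_derivative_at[symmetric] has_derivative_mult)

lemma Ck_add: "Ck k f \<Longrightarrow> Ck k g \<Longrightarrow> Ck k (\<lambda>x. f x + g x)"
proof (induction k arbitrary: f g)
  case 0
  then show ?case by (auto intro: continuous_on_add)
next
  case (Suc k)
  then show ?case by (auto simp: frechet_derivative_add_at intro: differentiable_add)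
qed

lemma Ck_mult:
  fixes f g :: "'a::euclidean_space \<Rightarrow> real"
  shows "Ck k f \<Longrightarrow> Ck k g \<Longrightarrow> Ck k (\<lambda>x. f x * g x)"
proof (induction k arbitrary: f g)
  case 0
  then show ?case by (auto intro: continuous_on_mult)
next
  case (Suc k)
  \<comment> \<open>The product rule also contains \<open>f\<close> and \<open>g\<close>
    undifferentiated, so both are needed at level \<open>k\<close>.\<close>
  have "Ck k f" "Ck k g"
    using Suc.prems by (blast dest: Ck_SucD)+
  then show ?case
    using Suc.prems Suc.IH
    by (auto simp: frechet_derivative_mult_at intro!: differentiable_mult Ck_add)
qed

lemma Ck_prod:
  fixes f :: "'i \<Rightarrow> 'a::euclidean_space \<Rightarrow> real"
  assumes "\<And>i. i \<in> A \<Longrightarrow> Ck k (f i)"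
  shows "Ck k (\<lambda>x. \<Prod>i\<in>A. f i x)"
  using assms
  by (induction A rule: infinite_finite_induct) (auto intro: Ck_const Ck_mult)

lemma Ck_inner: "Ck k (\<lambda>x. x \<bullet> u)"
proof (cases k)
  case 0
  then show ?thesis by (auto intro: continuous_intros)
next
  case (Suc m)
  have "((\<lambda>x. x \<bullet> u) has_derivative (\<lambda>b. b \<bullet> u)) (at x)" for x :: 'a
    by (auto intro!: derivative_eq_intros)
  then have "(\<lambda>x. x \<bullet> u) differentiable (at x)"
    and "frechet_derivative (\<lambda>x. x \<bullet> u) (at x) = (\<lambda>b. b \<bullet> u)" for x :: 'a
    by (auto simp: differentiable_def frechet_derivative_at[symmetric])
  then show ?thesis
    using Suc by (simp add: Ck_const)
qed

text \<open>The functions \<open>p (1/t) exp (-c/t)\<close> are closed under differentiation, which makes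
  smoothness an induction over all polynomials \<open>p\<close> at once.\<close>
definition flat :: "real \<Rightarrow> real poly \<Rightarrow> real \<Rightarrow> real" where
  "flat c p t = (if t > 0 then poly p (1 / t) * exp (- c / t) else 0)"

lemma power_mult_exp_tendsto_0:
  assumes "c > 0"
  shows "((\<lambda>y::real. y ^ k * exp (- c * y)) \<longlongrightarrow> 0) at_top"
  using assms by real_asymp

lemma poly_mult_exp_tendsto_0:
  assumes "c > 0"
  shows "((\<lambda>y::real. poly p y * exp (- c * y)) \<longlongrightarrow> 0) at_top"
proof -
  have "((\<lambda>y::real. \<Sum>i\<le>degree p. coeff p i * (y ^ i * exp (- c * y)))
      \<longlongrightarrow> (\<Sum>i\<le>degree p. coeff p i * 0)) at_top"
    by (intro tendsto_intros power_mult_exp_tendsto_0 assms)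
  then show ?thesis
    by (simp add: poly_altdef sum_distrib_right mult.assoc)
qed

text \<open>The substitution \<open>y = 1/t\<close> turns the limit from the right into one at
  infinity, where the exponential beats every polynomial. On the left the function is zero.\<close>

lemma flat_tendsto_0:
  assumes "c > 0"
  shows "(flat c p \<longlongrightarrow> 0) (at 0)"
proof -
  have "((\<lambda>t. poly p (inverse t) * exp (- c * inverse t)) \<longlongrightarrow> 0) (at_right 0)"
    by (rule filterlim_compose[OF poly_mult_exp_tendsto_0[OF assms] filterlim_inverse_at_top_right])
  then have "(flat c p \<longlongrightarrow> 0) (at_right 0)"
    by (rule Lim_transform_eventually)
      (auto simp: flat_def eventually_at_filter divide_inverse)
  moreover have "(flat c p \<longlongrightarrow> 0) (at_left 0)"
    by (rule tendsto_eventually) (auto simp: flat_def eventually_at_filter)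
  ultimately show ?thesis
    by (simp add: filterlim_split_at)
qed

text \<open>For positive \<open>t\<close> and \<open>y = 1/t\<close>, the product and chain rules
  replace \<open>p(y)\<close> by \<open>y^2 (c p(y) - p'(y))\<close>; the factor \<open>y^2\<close>
  comes from differentiating \<open>1/t\<close>. Only the origin needs a limit of difference
  quotients.\<close>

lemma flat_has_field_derivative:
  assumes c: "c > 0"
  shows "(flat c p has_field_derivative flat c ([:0, 0, 1:] * (smult c p - pderiv p)) t) (at t)"
proof -
  consider "t > 0" | "t < 0" | "t = 0" by linarith
  then show ?thesis
  proof cases
    case 1
    then have "((\<lambda>t. poly p (1 / t) * exp (- c / t)) has_field_derivative
        flat c ([:0, 0, 1:] * (smult c p - pderiv p)) t) (at t)"
      by (auto intro!: derivative_eq_intros DERIV_chain2[OF poly_DERIV]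
          simp: flat_def field_simps power2_eq_square)
    then show ?thesis
      by (rule has_field_derivative_transform_within_open[of _ _ _ "{0<..}"])
        (use 1 in \<open>auto simp: flat_def\<close>)
  next
    case 2
    have "((\<lambda>t. 0) has_field_derivative 0) (at t)" by simp
    then have "(flat c p has_field_derivative 0) (at t)"
      by (rule has_field_derivative_transform_within_open[of _ _ _ "{..<0}"])
        (use 2 in \<open>auto simp: flat_def\<close>)
    then show ?thesis using 2 by (simp add: flat_def)
  next
    case 3
    \<comment> \<open>The difference quotient \<open>flat c p h / h\<close> at the origin is again
      of the form \<open>flat\<close>: dividing by \<open>h\<close> multiplies the polynomial in
      \<open>1/h\<close> by its variable.\<close>
    have "(flat c ([:0, 1:] * p) \<longlongrightarrow> 0) (at 0)"
      by (rule flat_tendsto_0[OF c])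
    then have "((\<lambda>h. (flat c p (0 + h) - flat c p 0) / h) \<longlongrightarrow> 0) (at 0)"
      by (rule Lim_transform_eventually) (auto simp: flat_def eventually_at_filter)
    then show ?thesis using 3 by (simp add: DERIV_def flat_def)
  qed
qed

text \<open>Each directional derivative is a constant multiple of a function of the same shape.
  Affine arguments cover both kinds of factors of a bump, those for the lower and those for the
  upper faces of a box.\<close>

lemma Ck_flat:
  fixes u :: "'a::euclidean_space"
  assumes "c > 0"
  shows "Ck k (\<lambda>x. flat c p (x \<bullet> u + d))"
proof (induction k arbitrary: p)
  case 0
  have "isCont (flat c p) t" for t
    by (rule DERIV_isCont[OF flat_has_field_derivative[OF assms]])
  then have "continuous_on UNIV (flat c p)"
    by (simp add: continuous_at_imp_continuous_on)
  then have "continuous_on UNIV (\<lambda>x. flat c p (x \<bullet> u + d))"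
    by (rule continuous_on_compose2) (auto intro!: continuous_intros)
  then show ?case by simp
next
  case (Suc k)
  let ?q = "[:0, 0, 1:] * (smult c p - pderiv p)"
  have "((\<lambda>x. flat c p (x \<bullet> u + d)) has_derivative (\<lambda>b. flat c ?q (x \<bullet> u + d) * (b \<bullet> u))) (at x)"
    for x :: 'a
    by (rule has_derivative_eq_rhs[OF has_derivative_compose[OF _
            flat_has_field_derivative[OF assms, unfolded has_field_derivative_def]]])
      (auto intro!: derivative_eq_intros)
  then have "(\<lambda>x. flat c p (x \<bullet> u + d)) differentiable (at x)"
    and "frechet_derivative (\<lambda>x. flat c p (x \<bullet> u + d)) (at x) =
      (\<lambda>b. flat c ?q (x \<bullet> u + d) * (b \<bullet> u))" for x
    by (auto simp: differentiable_def frechet_derivative_at[symmetric])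
  then show ?case
    using Suc.IH by (simp del: mult_pCons_left add: Ck_mult Ck_const)
qed

text \<open>With the constant polynomial 1 each factor is \<open>exp(-c/t)\<close> on the inner side
  of a face and 0 beyond it. The parameter \<open>c\<close> controls the steepness: as
  \<open>c\<close> tends to 0 from above, the bumps tend to the indicator of the open box and stay
  bounded by 1.\<close>

definition bump :: "real \<Rightarrow> 'a::euclidean_space \<Rightarrow> 'a \<Rightarrow> 'a \<Rightarrow> real" where
  "bump c a b x = (\<Prod>i\<in>Basis. flat c 1 (x \<bullet> i - a \<bullet> i) * flat c 1 (b \<bullet> i - x \<bullet> i))"

lemma smooth_bump:
  assumes "c > 0"
  shows "smooth (bump c a b)"
proof -
  have "Ck k (\<lambda>x. flat c 1 (x \<bullet> i - a \<bullet> i) * flat c 1 (b \<bullet> i - x \<bullet> i))" for k i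
    using Ck_mult[OF Ck_flat[OF assms, of k 1 i "- (a \<bullet> i)"] Ck_flat[OF assms, of k 1 "-i" "b \<bullet> i"]]
    by simp
  then show ?thesis
    unfolding smooth_def bump_def by (intro allI Ck_prod)
qed

lemma bump_outside: "x \<notin> box a b \<Longrightarrow> bump c a b x = 0"
  by (force simp: bump_def box_def flat_def)

lemma flat_1_bounds:
  assumes "c > 0"
  shows "0 \<le> flat c 1 t" "flat c 1 t \<le> 1"
  using assms by (auto simp: flat_def)

lemma abs_bump_le_1: "c > 0 \<Longrightarrow> \<bar>bump c a b x\<bar> \<le> 1"
  unfolding bump_def abs_prod
  by (rule prod_le_1) (auto simp: abs_mult flat_1_bounds intro!: mult_le_one)

lemma bump_tendsto_indicator:
  "(\<lambda>m. bump (1 / real (Suc m)) a b x) \<longlonglongrightarrow> indicator (box a b) x"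
proof (cases "x \<in> box a b")
  case True
  have *: "(\<lambda>m. flat (1 / real (Suc m)) 1 t) \<longlonglongrightarrow> 1" if "t > 0" for t
  proof -
    have "(\<lambda>m. exp (- (inverse (real (Suc m)) / t))) \<longlonglongrightarrow> exp (- (0 / t))"
      by (intro tendsto_intros LIMSEQ_inverse_real_of_nat) (use that in auto)
    then show ?thesis using that by (simp add: flat_def divide_inverse)
  qed
  have "(\<lambda>m. bump (1 / real (Suc m)) a b x) \<longlonglongrightarrow> (\<Prod>i\<in>(Basis::'a set). 1 * 1)"
    unfolding bump_def by (intro tendsto_prod tendsto_mult *) (use True in \<open>auto simp: box_def\<close>)
  then show ?thesis using True by simp
qed (simp add: bump_outside)

text \<open>The support is closed and can reach the faces of the box, which is why the closed box
  has to lie in \<open>B\<close>.\<close>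

lemma test_fun_bump:
  assumes "c > 0" "cbox a b \<subseteq> B"
  shows "test_fun B (bump c a b)"
proof -
  have 1: "closure {x. bump c a b x \<noteq> 0} \<subseteq> cbox a b"
    using bump_outside box_subset_cbox[of a b] by (intro closure_minimal) (blast, rule closed_cbox)
  then have "bounded {x. bump c a b x \<noteq> 0}"
    using bounded_subset[OF bounded_cbox] closure_subset by blast
  then show ?thesis
    using 1 assms smooth_bump[OF assms(1)]
    by (auto simp: test_fun_def)
qed

section \<open>Test functions and the fundamental lemma\<close>

lemma test_fun_has_derivative:
  "test_fun B \<phi> \<Longrightarrow> (\<phi> has_derivative frechet_derivative \<phi> (at x)) (at x)"
proof -
  assume "test_fun B \<phi>"
  then have "Ck (Suc 0) \<phi>" unfolding test_fun_def smooth_def by blast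
  then show ?thesis by (simp add: frechet_derivative_works)
qed

lemma continuous_on_test_fun: "test_fun B \<phi> \<Longrightarrow> continuous_on UNIV \<phi>"
  using Ck.simps(1) unfolding test_fun_def smooth_def by blast

lemma continuous_on_pd:
  fixes \<phi> :: "real^'n \<Rightarrow> real"
  assumes "test_fun B \<phi>"
  shows "continuous_on UNIV (pd J \<phi>)"
proof -
  have "Ck (Suc 0) \<phi>" using assms unfolding test_fun_def smooth_def by blast
  then have "\<forall>b\<in>Basis. continuous_on UNIV (\<lambda>x. frechet_derivative \<phi> (at x) b)" by simp
  moreover have "axis J 1 \<in> (Basis :: (real^'n) set)" by (simp add: axis_in_Basis_iff)
  ultimately show ?thesis unfolding pd_def by blast
qed

text \<open>The complement of the support is open, so the function vanishes near each of its points
  and the derivative there is zero.\<close>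

lemma test_fun_outside:
  assumes "x \<notin> closure {x. \<phi> x \<noteq> 0}"
  shows "\<phi> x = 0" "pd J \<phi> x = 0"
proof -
  have *: "\<phi> y = 0" if "y \<notin> closure {x. \<phi> x \<noteq> 0}" for y
    using that subsetD[OF closure_subset, of y "{x. \<phi> x \<noteq> 0}"] by blast
  show "\<phi> x = 0" by (rule *[OF assms])
  have "(\<phi> has_derivative (\<lambda>b. 0)) (at x)"
  proof (rule has_derivative_transform_within_open)
    show "((\<lambda>x. 0) has_derivative (\<lambda>b. 0)) (at x)" by (rule has_derivative_const)
    show "open (- closure {x. \<phi> x \<noteq> 0})" by (intro open_Compl closed_closure)
    show "x \<in> - closure {x. \<phi> x \<noteq> 0}" by (simp only: Compl_iff assms not_False_eq_True)
    show "0 = \<phi> y" if "y \<in> - closure {x. \<phi> x \<noteq> 0}" for y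
      by (rule *[symmetric], rule ComplD, rule that)
  qed
  then show "pd J \<phi> x = 0" by (simp add: pd_def frechet_derivative_at[symmetric])
qed

lemma compact_support_bounded:
  fixes g :: "'a::euclidean_space \<Rightarrow> real"
  assumes "continuous_on UNIV g" "compact K" "\<And>x. x \<notin> K \<Longrightarrow> g x = 0"
  obtains M where "M \<ge> 0" "\<And>x. \<bar>g x\<bar> \<le> M"
proof -
  have "compact (g ` K)"
    using assms(1,2) continuous_on_subset[OF _ subset_UNIV] by (intro compact_continuous_image) blast+
  then obtain M where M: "\<And>x. x \<in> K \<Longrightarrow> \<bar>g x\<bar> \<le> M"
    using compact_imp_bounded bounded_iff by (metis image_eqI real_norm_def)
  have "\<bar>g x\<bar> \<le> \<bar>M\<bar>" for x
    using M[of x] assms(3)[of x] by (cases "x \<in> K") auto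
  then show ?thesis using that[of "\<bar>M\<bar>"] by auto
qed

lemma compact_support_integrable:
  fixes g :: "'a::euclidean_space \<Rightarrow> real"
  assumes "continuous_on UNIV g" "compact K" "\<And>x. x \<notin> K \<Longrightarrow> g x = 0"
  shows "integrable lborel g"
proof -
  have "integrable lborel (\<lambda>x. indicator K x *\<^sub>R g x)"
    using assms(1,2) continuous_on_subset[OF _ subset_UNIV] by (intro borel_integrable_compact) blast+
  moreover have "(\<lambda>x. indicator K x *\<^sub>R g x) = g"
    using assms(3) by (auto simp: fun_eq_iff indicator_def)
  ultimately show ?thesis by simp
qed

lemma test_fun_bounded:
  assumes "test_fun B \<phi>"
  obtains M where "M \<ge> 0" "\<And>x. \<bar>\<phi> x\<bar> \<le> M"
  using compact_support_bounded[OF continuous_on_test_fun[OF assms]] assms test_fun_outside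
  unfolding test_fun_def by metis

lemma pd_bounded:
  assumes "test_fun B \<phi>"
  obtains M where "M \<ge> 0" "\<And>x. \<bar>pd J \<phi> x\<bar> \<le> M"
  using compact_support_bounded[OF continuous_on_pd[OF assms]] assms test_fun_outside
  unfolding test_fun_def by metis

text \<open>This moves integrals over the region to \<open>lborel\<close> on the whole space, where
  translation invariance is applied. A Borel integrand vanishing outside \<open>B\<close> notices
  neither the restriction nor the completion.\<close>

lemma integral_lebesgue_on_eq_lborel:
  fixes g :: "'a::euclidean_space \<Rightarrow> real"
  assumes "open B" "g \<in> borel_measurable borel" "\<And>x. x \<notin> B \<Longrightarrow> g x = 0"
  shows "(\<integral>x. g x \<partial>lebesgue_on B) = (\<integral>x. g x \<partial>lborel)"
proof -
  have "(\<integral>x. g x \<partial>lebesgue_on B) = (\<integral>x. indicator B x *\<^sub>R g x \<partial>lebesgue)"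
    using assms(1) by (intro integral_restrict_space) auto
  also have "(\<lambda>x. indicator B x *\<^sub>R g x) = g"
    using assms(3) by (auto simp: fun_eq_iff indicator_def)
  also have "(\<integral>x. g x \<partial>lebesgue) = (\<integral>x. g x \<partial>lborel)"
    using assms(2) by (intro integral_completion) auto
  finally show ?thesis .
qed

text \<open>The difference quotients of \<open>\<phi>\<close> have integral zero, since Lebesgue measure is translation
  invariant.\<close>
lemma integral_pd_lborel_eq_0:
  fixes \<phi> :: "real^'n \<Rightarrow> real"
  assumes \<phi>: "test_fun B \<phi>"
  shows "(\<integral>x. pd J \<phi> x \<partial>lborel) = 0"
proof -
  define e :: "real^'n" where "e = axis J 1"
  define K where "K = closure {x. \<phi> x \<noteq> 0}"
  have "compact K" using \<phi> by (simp add: test_fun_def K_def)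
  then obtain r where r: "K \<subseteq> cball 0 r"
    using bounded_subset_ballD[OF compact_imp_bounded, of K 0] ball_subset_cball by (meson subset_trans)
  have out: "\<phi> x = 0" if "norm x > r" for x
    using that r test_fun_outside(1)[of x \<phi>] by (force simp: K_def)
  obtain M where M: "M \<ge> 0" "\<And>x. \<bar>pd J \<phi> x\<bar> \<le> M" using pd_bounded[OF \<phi>, of J] by metis
  define s where "s n x = (\<phi> (x + (1 / real (Suc n)) *\<^sub>R e) - \<phi> x) / (1 / real (Suc n))" for n x
  have int: "integrable lborel \<phi>"
    using compact_support_integrable[OF continuous_on_test_fun[OF \<phi>] \<open>compact K\<close>]
      test_fun_outside(1) K_def by blast
  have [measurable]: "\<phi> \<in> borel_measurable borel"
    using continuous_on_test_fun[OF \<phi>] by (rule borel_measurable_continuous_onI)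
  have [measurable]: "pd J \<phi> \<in> borel_measurable borel"
    using continuous_on_pd[OF \<phi>] by (rule borel_measurable_continuous_onI)
  have deriv: "((\<lambda>t. \<phi> (x + t *\<^sub>R e)) has_field_derivative pd J \<phi> (x + t *\<^sub>R e)) (at t)" for x t
  proof -
    interpret linear "frechet_derivative \<phi> (at (x + t *\<^sub>R e))"
      using has_derivative_linear[OF test_fun_has_derivative[OF \<phi>]] .
    have "((\<lambda>t. \<phi> (x + t *\<^sub>R e)) has_derivative
        (\<lambda>h. frechet_derivative \<phi> (at (x + t *\<^sub>R e)) (h *\<^sub>R e))) (at t)"
      by (rule has_derivative_compose[OF _ test_fun_has_derivative[OF \<phi>]])
        (auto intro!: derivative_eq_intros)
    moreover have "(\<lambda>h. frechet_derivative \<phi> (at (x + t *\<^sub>R e)) (h *\<^sub>R e))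
        = (*) (pd J \<phi> (x + t *\<^sub>R e))"
      by (auto simp: fun_eq_iff scale pd_def simp flip: e_def)
    ultimately show ?thesis by (simp add: has_field_derivative_def)
  qed
  have "(\<integral>x. s n x \<partial>lborel) = 0" for n
  proof -
    let ?c = "(1 / real (Suc n)) *\<^sub>R e"
    have 1: "integrable lborel (\<lambda>x. \<phi> (?c + x))"
      using int integrable_distr[of "(+) ?c" lborel borel \<phi>] by (simp add: lborel_distr_plus)
    have "(\<integral>x. \<phi> x \<partial>lborel) = (\<integral>x. \<phi> (?c + x) \<partial>lborel)"
      using integral_distr[of "(+) ?c" lborel borel \<phi>] by (simp add: lborel_distr_plus)
    then show ?thesis
      using 1 int unfolding s_def by (simp add: add.commute)
  qed
  moreover have "(\<lambda>n. \<integral>x. s n x \<partial>lborel) \<longlonglongrightarrow> (\<integral>x. pd J \<phi> x \<partial>lborel)"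
  \<comment> \<open>The steps have length at most 1, so every quotient vanishes outside the ball of
    radius \<open>r + 1\<close>. Inside, the mean value theorem bounds it by
    \<open>M\<close>.\<close>
  proof (rule integral_dominated_convergence[where w = "\<lambda>x. M * indicator (cball 0 (r + 1)) x"])
    show "s n \<in> borel_measurable lborel" for n unfolding s_def by measurable
    show "integrable lborel (\<lambda>x. M * indicator (cball (0::real^'n) (r + 1)) x)"
      by (intro integrable_mult_right integrable_real_indicator)
        (auto simp: emeasure_bounded_finite[OF bounded_cball, unfolded infinity_ennreal_def])
    have lim: "(\<lambda>n. s n x) \<longlonglongrightarrow> pd J \<phi> x" for x
    proof -
      have "((\<lambda>h. (\<phi> (x + (0 + h) *\<^sub>R e) - \<phi> (x + 0 *\<^sub>R e)) / h) \<longlongrightarrow> pd J \<phi> (x + 0 *\<^sub>R e)) (at 0)"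
        using deriv[of x 0] unfolding DERIV_def .
      from filterlim_compose[OF this] have ?thesis
        if "filterlim (\<lambda>n. 1 / real (Suc n)) (at 0) sequentially"
        using that unfolding s_def by (simp only: add_0_left scaleR_zero_left add_0_right)
      moreover have "filterlim (\<lambda>n. 1 / real (Suc n)) (at 0) sequentially"
        using LIMSEQ_inverse_real_of_nat by (intro filterlim_atI) (auto simp: divide_inverse)
      ultimately show ?thesis
        by blast
    qed
    then show "AE x in lborel. (\<lambda>n. s n x) \<longlonglongrightarrow> pd J \<phi> x" by simp
    show "AE x in lborel. norm (s n x) \<le> M * indicator (cball 0 (r + 1)) x" for n
    proof (rule AE_I2)
      fix x :: "real^'n"
      define h where "h = 1 / real (Suc n)"
      have h: "h > 0" "h \<le> 1" by (auto simp: h_def)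
      show "norm (s n x) \<le> M * indicator (cball 0 (r + 1)) x"
      proof (cases "x \<in> cball 0 (r + 1)")
        case True
        obtain z where "\<phi> (x + h *\<^sub>R e) - \<phi> (x + 0 *\<^sub>R e) = (h - 0) * pd J \<phi> (x + z *\<^sub>R e)"
          using MVT2[OF h(1) deriv] by blast
        then have "s n x = pd J \<phi> (x + z *\<^sub>R e)"
          using h unfolding s_def h_def[symmetric] by simp
        then show ?thesis using True M(2) by simp
      next
        case False
        have "norm (h *\<^sub>R e) \<le> 1" using h by (simp add: e_def)
        then have "norm (x + h *\<^sub>R e) > r" "norm x > r"
          using False norm_diff_ineq[of x "h *\<^sub>R e"] by auto
        then show ?thesis using False out unfolding s_def h_def[symmetric] by simp
      qed
    qed
  qed auto
  ultimately show ?thesis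
    by (simp add: LIMSEQ_const_iff)
qed

lemma integral_pd_eq_0:
  fixes \<phi> :: "real^'n \<Rightarrow> real"
  assumes "open B" "test_fun B \<phi>"
  shows "(\<integral>x. pd J \<phi> x \<partial>lebesgue_on B) = 0"
proof -
  have "(\<integral>x. pd J \<phi> x \<partial>lebesgue_on B) = (\<integral>x. pd J \<phi> x \<partial>lborel)"
    using assms test_fun_outside(2) unfolding test_fun_def
    by (intro integral_lebesgue_on_eq_lborel borel_measurable_continuous_onI
        continuous_on_pd[OF assms(2)]) blast+
  then show ?thesis using integral_pd_lborel_eq_0[OF assms(2)] by simp
qed

text \<open>Boxes are an intersection-stable generator of the Borel sets, so on a fixed closed box
  inside \<open>B\<close> vanishing integrals spread from boxes to all Borel sets. Countably many
  such closed boxes exhaust \<open>B\<close>.\<close>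

lemma AE_eq_0_if_box_integrals:
  fixes g :: "'a::euclidean_space \<Rightarrow> real"
  assumes "open B" and g: "integrable lborel g"
    and box0: "\<And>a b. cbox a b \<subseteq> B \<Longrightarrow> (LINT x:box a b|lborel. g x) = 0"
  shows "AE x in lborel. x \<in> B \<longrightarrow> g x = 0"
proof -
  have cbox: "AE x in lborel. x \<in> cbox c d \<longrightarrow> g x = 0" if cd: "cbox c d \<subseteq> B" for c d
  proof -
    \<comment> \<open>The hypothesis covers only boxes whose closure lies in \<open>B\<close>. The
      cut-off makes integrals over arbitrary Borel sets accessible.\<close>
    define h where "h = (\<lambda>x. indicator (box c d) x *\<^sub>R g x)"
    have h: "integrable lborel h"
      unfolding h_def using g by (intro integrable_mult_indicator) auto
    have 0: "integral\<^sup>L lborel h = 0"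
      using box0[OF cd] by (simp add: set_lebesgue_integral_def h_def)
    have "(LINT x:A|lborel. h x) = 0" if "A \<in> sets borel" for A
    proof -
      have "Int_stable (range (\<lambda>(a, b). box a b :: 'a set))"
        by (auto simp: Int_stable_def box_Int_box)
      moreover have "(range (\<lambda>(a, b). box a b :: 'a set)) \<subseteq> Pow UNIV" by auto
      moreover have "A \<in> sigma_sets UNIV (range (\<lambda>(a, b). box a b))"
        using that unfolding borel_eq_box by simp
      ultimately show ?thesis
      proof (induction rule: sigma_sets_induct_disjoint)
        case (basic A)
        then obtain a b where A: "A = box a b" by auto
        \<comment> \<open>These are the corners of the intersection with the fixed box, whose closed
          version therefore stays inside \<open>B\<close>.\<close>
        define l u where "l = (\<Sum>i\<in>Basis. max (a \<bullet> i) (c \<bullet> i) *\<^sub>R i)"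
          and "u = (\<Sum>i\<in>Basis. min (b \<bullet> i) (d \<bullet> i) *\<^sub>R i)"
        have 1: "box a b \<inter> box c d = box l u" "cbox a b \<inter> cbox c d = cbox l u"
          by (auto simp: box_Int_box Int_interval l_def u_def)
        have "indicator A x *\<^sub>R h x = indicator (box l u) x *\<^sub>R g x" for x
          unfolding A 1(1)[symmetric] h_def by (auto simp: indicator_def)
        moreover have "cbox l u \<subseteq> B" using 1(2) cd by blast
        ultimately show ?case
          using box0[of l u] by (simp add: set_lebesgue_integral_def)
      next
        case empty
        then show ?case by (simp add: set_lebesgue_integral_def)
      next
        case (compl A)
        then have [measurable]: "A \<in> sets borel" by (simp add: borel_eq_box)
        have "integrable lborel (\<lambda>x. indicator A x *\<^sub>R h x)"
          using h by (intro integrable_mult_indicator) auto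
        then have "(LINT x|lborel. h x - indicator A x *\<^sub>R h x) = 0"
          using h 0 compl.IH by (simp add: set_lebesgue_integral_def)
        moreover have "(\<lambda>x. h x - indicator A x *\<^sub>R h x) = (\<lambda>x. indicator (UNIV - A) x *\<^sub>R h x)"
          by (auto simp: indicator_def)
        ultimately show ?case by (simp add: set_lebesgue_integral_def)
      next
        case (union F)
        then have [measurable]: "\<And>i. F i \<in> sets borel" by (auto simp: borel_eq_box)
        have "(LINT x:(\<Union>i. F i)|lborel. h x) = (\<Sum>i. LINT x:F i|lborel. h x)"
        proof (rule lebesgue_integral_countable_add)
          show "set_integrable lborel (\<Union>i. F i) h"
            unfolding set_integrable_def using h by (intro integrable_mult_indicator) auto
        qed (use union.hyps(1) in \<open>auto simp: disjoint_family_on_def\<close>)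
        then show ?case using union.IH by simp
      qed
    qed
    then have "AE x in lborel. h x = 0"
      using h by (intro density_unique_real) (auto simp: set_lebesgue_integral_def)
    \<comment> \<open>\<open>h\<close> sees only the open box; its boundary is a null set.\<close>
    moreover have "AE x in lborel. x \<notin> cbox c d - box c d"
      by (rule AE_not_in) (simp add: null_sets_def emeasure_Diff box_subset_cbox emeasure_lborel_cbox_eq emeasure_lborel_box_eq)
    ultimately show ?thesis
      by eventually_elim (auto simp: h_def indicator_def split: if_splits)
  qed
  obtain \<D> where \<D>: "countable \<D>" "\<D> \<subseteq> Pow B" "\<And>X. X \<in> \<D> \<Longrightarrow> \<exists>a b. X = cbox a b" "\<Union>\<D> = B"
    using open_countable_Union_open_cbox[OF \<open>open B\<close>] by metis
  have "AE x in lborel. \<forall>X\<in>\<D>. x \<in> X \<longrightarrow> g x = 0"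
    unfolding AE_ball_countable[OF \<D>(1)]
  proof (intro ballI)
    fix X assume "X \<in> \<D>"
    then show "AE x in lborel. x \<in> X \<longrightarrow> g x = 0" using cbox \<D>(2,3) by blast
  qed
  then show ?thesis by eventually_elim (use \<D>(4) in blast)
qed

lemma integrable_mult_bounded_continuous:
  fixes f \<phi> :: "'a::euclidean_space \<Rightarrow> real"
  assumes "integrable (lebesgue_on B) f" "continuous_on UNIV \<phi>" "\<And>x. \<bar>\<phi> x\<bar> \<le> M"
  shows "integrable (lebesgue_on B) (\<lambda>x. f x * \<phi> x)"
proof (rule Bochner_Integration.integrable_bound)
  show "integrable (lebesgue_on B) (\<lambda>x. M * f x)" using assms(1) by simp
  have "\<phi> \<in> borel_measurable borel"
    using assms(2) by (rule borel_measurable_continuous_onI)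
  then have "\<phi> \<in> borel_measurable (lebesgue_on B)"
    by (intro measurable_restrict_space1 measurable_completion) simp
  then show "(\<lambda>x. f x * \<phi> x) \<in> borel_measurable (lebesgue_on B)"
    using assms(1) by (intro borel_measurable_times) auto
  show "AE x in lebesgue_on B. norm (f x * \<phi> x) \<le> norm (M * f x)"
  proof (rule AE_I2)
    fix x
    have "\<bar>\<phi> x\<bar> * \<bar>f x\<bar> \<le> \<bar>M\<bar> * \<bar>f x\<bar>"
      using assms(3)[of x] by (intro mult_right_mono) auto
    then show "norm (f x * \<phi> x) \<le> norm (M * f x)" by (simp add: abs_mult mult.commute)
  qed
qed

text \<open>Bumps converging to the indicator of a box are admissible test functions. Dominated
  convergence, with the modulus of the integrand as bound, shows that the integrals over boxes
  vanish.\<close>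

lemma fundamental_lemma:
  fixes f :: "real^'n \<Rightarrow> real"
  assumes B: "open B" and f: "integrable (lebesgue_on B) f"
    and test: "\<And>\<phi>. test_fun B \<phi> \<Longrightarrow> (\<integral>x. f x * \<phi> x \<partial>lebesgue_on B) = 0"
  shows "AE x in lebesgue_on B. f x = 0"
proof -
  define F where "F = (\<lambda>x. indicator B x *\<^sub>R f x)"
  have F: "integrable lebesgue F"
    using f B by (simp add: F_def integrable_restrict_space)
  \<comment> \<open>The extension by zero is measurable only for the completed measure, while the
    box argument uses \<open>lborel\<close>. A Borel representative bridges the two.\<close>
  obtain g where g[measurable]: "g \<in> borel_measurable lborel" and Fg: "AE x in lborel. F x = g x"
    using completion_ex_borel_measurable_real[of F lborel] F by auto
  have Fg': "AE x in lebesgue. F x = g x"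
    using Fg by (rule AE_completion)
  have "integrable lebesgue g"
    using F Fg' g by (subst integrable_cong_AE[where g = F]) (auto intro: measurable_completion)
  then have gint: "integrable lborel g"
    using g by (simp add: integrable_completion)
  have "(LINT x:box a b|lborel. g x) = 0" if ab: "cbox a b \<subseteq> B" for a b
  proof -
    let ?\<phi> = "\<lambda>m. bump (1 / real (Suc m)) a b"
    have \<phi>: "test_fun B (?\<phi> m)" for m using ab by (intro test_fun_bump) auto
    have \<phi>_meas: "?\<phi> m \<in> borel_measurable borel" for m
      using continuous_on_test_fun[OF \<phi>] by (rule borel_measurable_continuous_onI)
    then have \<phi>_meas': "?\<phi> m \<in> borel_measurable lebesgue" for m
      by (intro measurable_completion) simp
    have "(\<integral>x. g x * ?\<phi> m x \<partial>lborel) = 0" for m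
    proof -
      have "(\<integral>x. g x * ?\<phi> m x \<partial>lborel) = (\<integral>x. g x * ?\<phi> m x \<partial>lebesgue)"
        using g \<phi>_meas by (intro integral_completion[symmetric] borel_measurable_times) simp_all
      also have "\<dots> = (\<integral>x. F x * ?\<phi> m x \<partial>lebesgue)"
      proof (rule integral_cong_AE)
        show "(\<lambda>x. g x * ?\<phi> m x) \<in> borel_measurable lebesgue"
          using g by (intro borel_measurable_times \<phi>_meas' measurable_completion)
        show "(\<lambda>x. F x * ?\<phi> m x) \<in> borel_measurable lebesgue"
          using F by (intro borel_measurable_times \<phi>_meas' borel_measurable_integrable)
        show "AE x in lebesgue. g x * ?\<phi> m x = F x * ?\<phi> m x"
          using Fg' by eventually_elim simp
      qed
      also have "\<dots> = (\<integral>x. indicator B x *\<^sub>R (f x * ?\<phi> m x) \<partial>lebesgue)"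
        by (simp add: F_def mult.assoc)
      also have "\<dots> = (\<integral>x. f x * ?\<phi> m x \<partial>lebesgue_on B)"
        using B by (intro integral_restrict_space[symmetric]) auto
      also have "\<dots> = 0" by (rule test[OF \<phi>])
      finally show ?thesis .
    qed
    moreover have "(\<lambda>m. \<integral>x. g x * ?\<phi> m x \<partial>lborel) \<longlonglongrightarrow> (\<integral>x. g x * indicator (box a b) x \<partial>lborel)"
    proof (rule integral_dominated_convergence[where w = "\<lambda>x. norm (g x)"])
      show "AE x in lborel. (\<lambda>m. g x * ?\<phi> m x) \<longlonglongrightarrow> g x * indicator (box a b) x"
        by (intro AE_I2 tendsto_intros bump_tendsto_indicator)
      show "AE x in lborel. norm (g x * ?\<phi> m x) \<le> norm (g x)" for m
        by (intro AE_I2) (simp add: abs_mult mult_left_le abs_bump_le_1)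
    qed (use g \<phi>_meas gint in auto)
    ultimately have "(\<integral>x. g x * indicator (box a b) x \<partial>lborel) = 0"
      by (simp add: LIMSEQ_const_iff)
    then show ?thesis by (simp add: set_lebesgue_integral_def mult.commute)
  qed
  then have "AE x in lborel. x \<in> B \<longrightarrow> g x = 0"
    by (intro AE_eq_0_if_box_integrals B gint)
  then have "AE x in lebesgue. x \<in> B \<longrightarrow> g x = 0" by (rule AE_completion)
  with Fg' have "AE x in lebesgue. x \<in> B \<longrightarrow> f x = 0"
    by eventually_elim (auto simp: F_def)
  then show ?thesis using B by (simp add: AE_restrict_space_iff)
qed

section \<open>Uniqueness of weak derivatives\<close>

text \<open>Components are rewritten as inner products with a fixed element, so that vector and
  tensor fields share the same integrability and uniqueness lemmas.\<close>

lemma nth_eq_inner: "(v :: real^'m) $ i = v \<bullet> axis i 1"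
  by (simp add: inner_axis)

lemma nth_nth_eq_inner: "(A :: real^'m^'k) $ i $ j = A \<bullet> axis i (axis j 1)"
  by (simp add: inner_axis)

lemma AE_vec_eqI:
  fixes f g :: "'a \<Rightarrow> 'b^'m"
  assumes "\<And>i. AE x in M. f x $ i = g x $ i"
  shows "AE x in M. f x = g x"
proof -
  have "AE x in M. \<forall>i. f x $ i = g x $ i" by (rule eventually_all_finite) (rule assms)
  then show ?thesis by (simp add: vec_eq_iff)
qed

lemma L2_inner_cong_AE:
  assumes "f \<in> L2 M" "f' \<in> L2 M" "g \<in> L2 M" "g' \<in> L2 M"
    and "AE x in M. f x = f' x" "AE x in M. g x = g' x"
  shows "L2_inner M f g = L2_inner M f' g'"
  unfolding L2_inner_def
proof (rule integral_cong_AE)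
  show "(\<lambda>x. f x \<bullet> g x) \<in> borel_measurable M" "(\<lambda>x. f' x \<bullet> g' x) \<in> borel_measurable M"
    using assms(1-4) by (auto simp: L2_def intro!: borel_measurable_inner)
  show "AE x in M. f x \<bullet> g x = f' x \<bullet> g' x"
    using assms(5,6) by eventually_elim simp
qed

lemma L2_inner_zero [simp]: "L2_inner M f 0 = 0" "L2_inner M 0 f = 0"
  by (simp_all add: L2_inner_def zero_fun_def)

context
  fixes B :: "(real^'n) set"
  assumes B: "open B" "bounded B"
begin

section \<open>Square-integrable fields on a bounded open region\<close>

lemma finite_measure_region: "finite_measure (lebesgue_on B)"
  using B by (intro finite_measure_lebesgue_on lmeasurable_open)

lemma L2_const: "(\<lambda>_. c) \<in> L2 (lebesgue_on B)"
  using finite_measure.integrable_const[OF finite_measure_region] by (auto simp: L2_def)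

lemma L2_zero: "0 \<in> L2 (lebesgue_on B)"
  using L2_const[of 0] by (simp add: zero_fun_def)

lemma L2_scaled_ident: "(\<lambda>x. t *\<^sub>R x) \<in> L2 (lebesgue_on B)"
proof -
  obtain r where r: "\<And>x. x \<in> B \<Longrightarrow> norm x \<le> r" using B(2) bounded_iff by metis
  have m: "(\<lambda>x. t *\<^sub>R x) \<in> borel_measurable (lebesgue_on B)"
    by (intro measurable_restrict_space1 measurable_completion) simp
  have "integrable (lebesgue_on B) (\<lambda>x. (norm (t *\<^sub>R x))\<^sup>2)"
  proof (rule finite_measure.integrable_const_bound[OF finite_measure_region])
    show "AE x in lebesgue_on B. norm ((norm (t *\<^sub>R x))\<^sup>2) \<le> (\<bar>t\<bar> * r)\<^sup>2"
      using r by (intro AE_I2) (auto intro!: power_mono mult_left_mono)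
    show "(\<lambda>x. (norm (t *\<^sub>R x))\<^sup>2) \<in> borel_measurable (lebesgue_on B)"
      by (intro borel_measurable_power measurable_compose[OF m borel_measurable_norm])
  qed
  then show ?thesis using m by (simp add: L2_def)
qed

text \<open>On a region of finite measure square-integrability implies integrability, because
  \<open>norm (f x)\<close> is at most \<open>1 + (norm (f x))^2\<close>.\<close>

lemma L2_integrable_inner:
  assumes "f \<in> L2 (lebesgue_on B)"
  shows "integrable (lebesgue_on B) (\<lambda>x. f x \<bullet> u)"
proof (rule Bochner_Integration.integrable_bound)
  have m: "f \<in> borel_measurable (lebesgue_on B)" and i: "integrable (lebesgue_on B) (\<lambda>x. (norm (f x))\<^sup>2)"
    using assms by (auto simp: L2_def)
  show "integrable (lebesgue_on B) (\<lambda>x. norm u * (1 + (norm (f x))\<^sup>2))"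
    using i finite_measure.integrable_const[OF finite_measure_region, of "1::real"]
    by (intro integrable_mult_right Bochner_Integration.integrable_add)
  show "(\<lambda>x. f x \<bullet> u) \<in> borel_measurable (lebesgue_on B)"
    using m by (intro borel_measurable_inner) auto
  have "\<bar>f x \<bullet> u\<bar> \<le> norm u * (1 + (norm (f x))\<^sup>2)" for x
  proof -
    have "2 * norm (f x) \<le> 1 + (norm (f x))\<^sup>2"
      using sum_squares_bound[of "norm (f x)" 1] by simp
    then have "norm (f x) \<le> 1 + (norm (f x))\<^sup>2"
      using norm_ge_zero[of "f x"] by linarith
    then have "norm u * norm (f x) \<le> norm u * (1 + (norm (f x))\<^sup>2)"
      by (intro mult_left_mono) auto
    then show ?thesis using Cauchy_Schwarz_ineq2[of "f x" u] by (simp add: mult.commute)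
  qed
  then show "AE x in lebesgue_on B. norm (f x \<bullet> u) \<le> norm (norm u * (1 + (norm (f x))\<^sup>2))"
    by (intro AE_I2) (smt (verit) real_norm_def)
qed

lemma L2_integrable_mult_pd:
  assumes "f \<in> L2 (lebesgue_on B)" "test_fun B \<phi>"
  shows "integrable (lebesgue_on B) (\<lambda>x. (f x \<bullet> u) * pd J \<phi> x)"
proof -
  obtain M where "\<And>x. \<bar>pd J \<phi> x\<bar> \<le> M" using pd_bounded[OF assms(2), of J] by metis
  then show ?thesis
    using integrable_mult_bounded_continuous L2_integrable_inner[OF assms(1)] continuous_on_pd[OF assms(2)]
    by blast
qed

lemma L2_integrable_mult_test_fun:
  assumes "f \<in> L2 (lebesgue_on B)" "test_fun B \<phi>"
  shows "integrable (lebesgue_on B) (\<lambda>x. (f x \<bullet> u) * \<phi> x)"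
proof -
  obtain M where "\<And>x. \<bar>\<phi> x\<bar> \<le> M" using test_fun_bounded[OF assms(2)] by metis
  then show ?thesis
    using integrable_mult_bounded_continuous L2_integrable_inner[OF assms(1)] continuous_on_test_fun[OF assms(2)]
    by blast
qed

text \<open>The fundamental lemma is applied to the difference. The uniqueness of weak gradients,
  divergences and curls reduces to this statement, one component at a time.\<close>

lemma weak_component_unique:
  assumes f: "f \<in> L2 (lebesgue_on B)" and g: "g \<in> L2 (lebesgue_on B)"
    and eq: "\<And>\<phi>. test_fun B \<phi> \<Longrightarrow>
      (\<integral>x. (f x \<bullet> u) * \<phi> x \<partial>lebesgue_on B) = (\<integral>x. (g x \<bullet> u) * \<phi> x \<partial>lebesgue_on B)"
  shows "AE x in lebesgue_on B. f x \<bullet> u = g x \<bullet> u"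
proof -
  have "AE x in lebesgue_on B. f x \<bullet> u - g x \<bullet> u = 0"
  proof (rule fundamental_lemma[OF B(1)])
    show "integrable (lebesgue_on B) (\<lambda>x. f x \<bullet> u - g x \<bullet> u)"
      by (intro Bochner_Integration.integrable_diff L2_integrable_inner f g)
    show "(\<integral>x. (f x \<bullet> u - g x \<bullet> u) * \<phi> x \<partial>lebesgue_on B) = 0" if "test_fun B \<phi>" for \<phi>
      using eq[OF that] L2_integrable_mult_test_fun[OF f that] L2_integrable_mult_test_fun[OF g that]
      by (simp add: left_diff_distrib)
  qed
  then show ?thesis by simp
qed

text \<open>One known weak gradient guarantees that the choice behind \<open>wgrad\<close> succeeds;
  uniqueness then identifies the chosen field almost everywhere. The next three lemmas follow the
  same pattern.\<close>

lemma wgrad_AE_eq: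
  assumes "G \<in> L2 (lebesgue_on B)" "is_weak_grad B U G"
  shows "wgrad B U \<in> L2 (lebesgue_on B)" "AE x in lebesgue_on B. wgrad B U x = G x"
proof -
  have *: "wgrad B U \<in> L2 (lebesgue_on B) \<and> is_weak_grad B U (wgrad B U)"
    using someI[of "\<lambda>G. G \<in> L2 (lebesgue_on B) \<and> is_weak_grad B U G" G] assms
    unfolding wgrad_def by blast
  then show "wgrad B U \<in> L2 (lebesgue_on B)" by blast
  show "AE x in lebesgue_on B. wgrad B U x = G x"
  proof (intro AE_vec_eqI)
    fix I J
    show "AE x in lebesgue_on B. wgrad B U x $ I $ J = G x $ I $ J"
      unfolding nth_nth_eq_inner using * assms
      by (intro weak_component_unique) (simp_all add: is_weak_grad_def flip: nth_nth_eq_inner)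
  qed
qed

lemma wdiv_AE_eq:
  assumes "D \<in> L2 (lebesgue_on B)" "is_weak_div B T D"
  shows "wdiv B T \<in> L2 (lebesgue_on B)" "AE x in lebesgue_on B. wdiv B T x = D x"
proof -
  have *: "wdiv B T \<in> L2 (lebesgue_on B) \<and> is_weak_div B T (wdiv B T)"
    using someI[of "\<lambda>D. D \<in> L2 (lebesgue_on B) \<and> is_weak_div B T D" D] assms
    unfolding wdiv_def by blast
  then show "wdiv B T \<in> L2 (lebesgue_on B)" by blast
  show "AE x in lebesgue_on B. wdiv B T x = D x"
  proof (intro AE_vec_eqI)
    fix I
    show "AE x in lebesgue_on B. wdiv B T x $ I = D x $ I"
      unfolding nth_eq_inner using * assms
      by (intro weak_component_unique) (simp_all add: is_weak_div_def flip: nth_eq_inner)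
  qed
qed

lemma wcurl2_AE_eq:
  assumes "C \<in> L2 (lebesgue_on B)" "is_weak_curl2 ix B T C"
  shows "wcurl2 ix B T \<in> L2 (lebesgue_on B)" "AE x in lebesgue_on B. wcurl2 ix B T x = C x"
proof -
  have *: "wcurl2 ix B T \<in> L2 (lebesgue_on B) \<and> is_weak_curl2 ix B T (wcurl2 ix B T)"
    using someI[of "\<lambda>C. C \<in> L2 (lebesgue_on B) \<and> is_weak_curl2 ix B T C" C] assms
    unfolding wcurl2_def by blast
  then show "wcurl2 ix B T \<in> L2 (lebesgue_on B)" by blast
  show "AE x in lebesgue_on B. wcurl2 ix B T x = C x"
  proof (intro AE_vec_eqI)
    fix I
    show "AE x in lebesgue_on B. wcurl2 ix B T x $ I = C x $ I"
      unfolding nth_eq_inner using * assms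
      by (intro weak_component_unique) (simp_all add: is_weak_curl2_def flip: nth_eq_inner)
  qed
qed

text \<open>The weak curl is tested only on components numbered by \<open>ix\<close>, so the
  numbering has to reach every coordinate.\<close>

lemma wcurl3_AE_eq:
  assumes ix: "ix ` {1..3} = UNIV"
    and "C \<in> L2 (lebesgue_on B)" "is_weak_curl3 ix B T C"
  shows "wcurl3 ix B T \<in> L2 (lebesgue_on B)" "AE x in lebesgue_on B. wcurl3 ix B T x = C x"
proof -
  have *: "wcurl3 ix B T \<in> L2 (lebesgue_on B) \<and> is_weak_curl3 ix B T (wcurl3 ix B T)"
    using someI[of "\<lambda>C. C \<in> L2 (lebesgue_on B) \<and> is_weak_curl3 ix B T C" C] assms
    unfolding wcurl3_def by blast
  then show "wcurl3 ix B T \<in> L2 (lebesgue_on B)" by blast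
  show "AE x in lebesgue_on B. wcurl3 ix B T x = C x"
  proof (intro AE_vec_eqI)
    fix I J
    obtain j where j: "j \<in> {1..3}" "J = ix j" using ix by (metis UNIV_I imageE)
    show "AE x in lebesgue_on B. wcurl3 ix B T x $ I $ J = C x $ I $ J"
      unfolding nth_nth_eq_inner using * assms(2,3) j
      by (intro weak_component_unique) (simp_all add: is_weak_curl3_def flip: nth_nth_eq_inner)
  qed
qed

section \<open>Gradient and norm of multiples of the identity field\<close>

lemma L2_inner_const:
  "L2_inner (lebesgue_on B) (\<lambda>_. c) (\<lambda>_. d) = measure lebesgue B * (c \<bullet> d)"
  using B by (simp add: L2_inner_def measure_restrict_space)

text \<open>The product of a coordinate function with a test function is again a test function,
  hence its partial derivative has integral zero. Expanding that derivative gives the integration by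
  parts formula.\<close>

lemma is_weak_grad_scaled_ident: "is_weak_grad B (\<lambda>x. t *\<^sub>R x) (\<lambda>_. t *\<^sub>R mat 1)"
  unfolding is_weak_grad_def
proof (intro allI impI)
  fix \<phi> :: "real^'n \<Rightarrow> real" and I J :: 'n
  assume \<phi>: "test_fun B \<phi>"
  define \<psi> where "\<psi> x = (x \<bullet> axis I 1) * \<phi> x" for x
  have sub: "closure {x. \<psi> x \<noteq> 0} \<subseteq> closure {x. \<phi> x \<noteq> 0}"
    by (intro closure_mono) (auto simp: \<psi>_def)
  have "Ck k \<psi>" for k
    unfolding \<psi>_def using \<phi> by (intro Ck_mult Ck_inner) (auto simp: test_fun_def smooth_def)
  moreover have "compact (closure {x. \<psi> x \<noteq> 0})"
    using \<phi> sub by (metis test_fun_def closed_closure closed_Int_compact inf.absorb_iff1)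
  ultimately have \<psi>: "test_fun B \<psi>"
    using sub \<phi> by (auto simp: test_fun_def smooth_def)
  have pd: "pd J \<psi> x = (x \<bullet> axis I 1) * pd J \<phi> x + (mat 1 $ I $ J) * \<phi> x" for x
  proof -
    have "(\<psi> has_derivative (\<lambda>b. (x \<bullet> axis I 1) * frechet_derivative \<phi> (at x) b
        + (b \<bullet> axis I 1) * \<phi> x)) (at x)"
      unfolding \<psi>_def
      by (intro has_derivative_mult test_fun_has_derivative[OF \<phi>] has_derivative_inner_left
          has_derivative_ident)
    then show ?thesis
      by (simp add: pd_def frechet_derivative_at[symmetric] inner_axis_axis mat_def)
  qed
  have id: "(\<lambda>x. x) \<in> L2 (lebesgue_on B)" using L2_scaled_ident[of 1] by simp
  have 1: "integrable (lebesgue_on B) (\<lambda>x. (x \<bullet> axis I 1) * pd J \<phi> x)"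
    using L2_integrable_mult_pd[OF id \<phi>] .
  have 2: "integrable (lebesgue_on B) (\<lambda>x. (mat 1 $ I $ J) * \<phi> x)"
    using L2_integrable_mult_test_fun[OF L2_const[of "1::real"] \<phi>, of 1] by simp
  have "0 = (\<integral>x. pd J \<psi> x \<partial>lebesgue_on B)"
    using integral_pd_eq_0[OF B(1) \<psi>] by simp
  also have "\<dots> = (\<integral>x. (x \<bullet> axis I 1) * pd J \<phi> x \<partial>lebesgue_on B)
      + (\<integral>x. (mat 1 $ I $ J) * \<phi> x \<partial>lebesgue_on B)"
    unfolding pd by (rule Bochner_Integration.integral_add[OF 1 2])
  finally have "t * (\<integral>x. (mat 1 $ I $ J) * \<phi> x \<partial>lebesgue_on B)
      = - (t * (\<integral>x. (x \<bullet> axis I 1) * pd J \<phi> x \<partial>lebesgue_on B))"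
    by (simp add: eq_neg_iff_add_eq_0 add.commute flip: distrib_left)
  then show "(\<integral>x. (t *\<^sub>R mat 1) $ I $ J * \<phi> x \<partial>lebesgue_on B)
      = - (\<integral>x. (t *\<^sub>R x) $ I * pd J \<phi> x \<partial>lebesgue_on B)"
    by (simp add: mult.assoc flip: nth_eq_inner)
qed

lemma scaled_ident_H1: "(\<lambda>x. t *\<^sub>R x) \<in> H1 B"
  using L2_scaled_ident L2_const is_weak_grad_scaled_ident unfolding H1_def by blast

lemma wgrad_scaled_ident:
  "wgrad B (\<lambda>x. t *\<^sub>R x) \<in> L2 (lebesgue_on B)"
  "AE x in lebesgue_on B. wgrad B (\<lambda>x. t *\<^sub>R x) x = t *\<^sub>R mat 1"
  using wgrad_AE_eq[OF L2_const is_weak_grad_scaled_ident] by auto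

text \<open>Homogeneity is not immediate from the definition, since the gradients of different
  multiples are chosen separately. Replacing them by their almost everywhere values settles
  it.\<close>

lemma H1_norm_scaled_ident: "H1_norm B (\<lambda>x. t *\<^sub>R x) = \<bar>t\<bar> * H1_norm B (\<lambda>x. x)"
proof -
  define c where "c = L2_inner (lebesgue_on B) (\<lambda>x. x) (\<lambda>x. x)
    + measure lebesgue B * (mat 1 \<bullet> (mat 1 :: real^'n^'n))"
  have *: "H1_norm B (\<lambda>x. t *\<^sub>R x) = sqrt (t\<^sup>2 * c)" for t
  proof -
    have "L2_inner (lebesgue_on B) (wgrad B (\<lambda>x. t *\<^sub>R x)) (wgrad B (\<lambda>x. t *\<^sub>R x))
        = L2_inner (lebesgue_on B) (\<lambda>_. t *\<^sub>R mat 1) (\<lambda>_. t *\<^sub>R mat 1 :: real^'n^'n)"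
      by (intro L2_inner_cong_AE wgrad_scaled_ident L2_const)
    also have "\<dots> = t\<^sup>2 * (measure lebesgue B * (mat 1 \<bullet> (mat 1 :: real^'n^'n)))"
      by (simp add: L2_inner_const power2_eq_square)
    finally show ?thesis
      by (simp add: H1_norm_def c_def L2_inner_def distrib_left power2_eq_square mult.assoc)
  qed
  from *[of t] *[of 1] show ?thesis by (simp add: real_sqrt_mult)
qed

section \<open>Constant tensors and the zero field in the curl and divergence spaces\<close>

lemma integral_const_mult_pd:
  "test_fun B \<phi> \<Longrightarrow> (\<integral>x. a * pd J \<phi> x \<partial>lebesgue_on B) = 0"
  using integral_pd_eq_0[OF B(1)] by simp

text \<open>The constant contributes only integrals of derivatives of test functions, and these
  vanish.\<close>

lemma is_weak_curl2_add_const: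
  assumes K: "K \<in> L2 (lebesgue_on B)" and C: "is_weak_curl2 ix B K C"
  shows "is_weak_curl2 ix B (\<lambda>x. K x + c) C"
  unfolding is_weak_curl2_def
proof (intro allI impI)
  fix \<phi> I
  assume \<phi>: "test_fun B \<phi>"
  have i: "integrable (lebesgue_on B) (\<lambda>x. K x $ I $ j * pd k \<phi> x)"
    "integrable (lebesgue_on B) (\<lambda>x. c $ I $ j * pd k \<phi> x)" for j k
    unfolding nth_nth_eq_inner by (intro L2_integrable_mult_pd K L2_const \<phi>)+
  have "(\<integral>x. (K x + c) $ I $ ix 2 * pd (ix 1) \<phi> x - (K x + c) $ I $ ix 1 * pd (ix 2) \<phi> x \<partial>lebesgue_on B)
      = (\<integral>x. (K x $ I $ ix 2 * pd (ix 1) \<phi> x - K x $ I $ ix 1 * pd (ix 2) \<phi> x)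
        + (c $ I $ ix 2 * pd (ix 1) \<phi> x - c $ I $ ix 1 * pd (ix 2) \<phi> x) \<partial>lebesgue_on B)"
    by (simp add: algebra_simps)
  also have "\<dots> = (\<integral>x. K x $ I $ ix 2 * pd (ix 1) \<phi> x - K x $ I $ ix 1 * pd (ix 2) \<phi> x \<partial>lebesgue_on B)
     + ((\<integral>x. c $ I $ ix 2 * pd (ix 1) \<phi> x \<partial>lebesgue_on B)
        - (\<integral>x. c $ I $ ix 1 * pd (ix 2) \<phi> x \<partial>lebesgue_on B))"
    by (simp only: Bochner_Integration.integral_diff[OF i(2) i(2)] Bochner_Integration.integral_add[OF
          Bochner_Integration.integrable_diff[OF i(1) i(1)] Bochner_Integration.integrable_diff[OF i(2) i(2)]])
  also have "\<dots> = (\<integral>x. K x $ I $ ix 2 * pd (ix 1) \<phi> x - K x $ I $ ix 1 * pd (ix 2) \<phi> x \<partial>lebesgue_on B)"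
    by (simp only: integral_const_mult_pd[OF \<phi>] diff_self add_0_right)
  finally show "(\<integral>x. C x $ I * \<phi> x \<partial>lebesgue_on B) = - (\<integral>x. (K x + c) $ I $ ix 2 * pd (ix 1) \<phi> x
      - (K x + c) $ I $ ix 1 * pd (ix 2) \<phi> x \<partial>lebesgue_on B)"
    using C \<phi> unfolding is_weak_curl2_def by simp
qed

lemma is_weak_curl3_add_const:
  assumes K: "K \<in> L2 (lebesgue_on B)" and C: "is_weak_curl3 ix B K C"
  shows "is_weak_curl3 ix B (\<lambda>x. K x + c) C"
  unfolding is_weak_curl3_def
proof (intro allI ballI impI)
  fix \<phi> I and j :: nat
  assume j: "j \<in> {1..3}" and \<phi>: "test_fun B \<phi>"
  have i: "integrable (lebesgue_on B) (\<lambda>x. levi_civita j k l * K x $ I $ ix l * pd (ix k) \<phi> x)"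
    "integrable (lebesgue_on B) (\<lambda>x. levi_civita j k l * c $ I $ ix l * pd (ix k) \<phi> x)" for k l
    unfolding mult.assoc nth_nth_eq_inner
    by (intro integrable_mult_right L2_integrable_mult_pd K L2_const \<phi>)+
  have "(\<integral>x. (\<Sum>k=1..3. \<Sum>l=1..3. levi_civita j k l * (K x + c) $ I $ ix l * pd (ix k) \<phi> x) \<partial>lebesgue_on B)
      = (\<integral>x. (\<Sum>k=1..3. \<Sum>l=1..3. levi_civita j k l * K x $ I $ ix l * pd (ix k) \<phi> x)
        + (\<Sum>k=1..3. \<Sum>l=1..3. levi_civita j k l * c $ I $ ix l * pd (ix k) \<phi> x) \<partial>lebesgue_on B)"
    by (simp only: vector_add_component distrib_left distrib_right sum.distrib)
  also have "\<dots> = (\<integral>x. (\<Sum>k=1..3. \<Sum>l=1..3. levi_civita j k l * K x $ I $ ix l * pd (ix k) \<phi> x) \<partial>lebesgue_on B)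
     + (\<integral>x. (\<Sum>k=1..3. \<Sum>l=1..3. levi_civita j k l * c $ I $ ix l * pd (ix k) \<phi> x) \<partial>lebesgue_on B)"
    by (intro Bochner_Integration.integral_add Bochner_Integration.integrable_sum i)
  also have "(\<integral>x. (\<Sum>k=1..3. \<Sum>l=1..3. levi_civita j k l * c $ I $ ix l * pd (ix k) \<phi> x) \<partial>lebesgue_on B)
     = (\<Sum>k=1..3. \<Sum>l=1..3. \<integral>x. levi_civita j k l * c $ I $ ix l * pd (ix k) \<phi> x \<partial>lebesgue_on B)"
    by (simp only: Bochner_Integration.integral_sum Bochner_Integration.integrable_sum i)
  also have "\<dots> = 0"
    by (simp only: integral_const_mult_pd[OF \<phi>] sum.neutral_const)
  finally show "(\<integral>x. C x $ I $ ix j * \<phi> x \<partial>lebesgue_on B)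
      = - (\<integral>x. (\<Sum>k=1..3. \<Sum>l=1..3. levi_civita j k l * (K x + c) $ I $ ix l * pd (ix k) \<phi> x) \<partial>lebesgue_on B)"
    using C \<phi> j unfolding is_weak_curl3_def by simp
qed

lemma Hc_add_const:
  assumes "K \<in> Hc ix B"
  shows "(\<lambda>x. K x + c) \<in> Hc ix B"
proof -
  have K: "K \<in> L2 (lebesgue_on B)" using assms by (auto simp: Hc_def)
  then have m: "K \<in> borel_measurable (lebesgue_on B)" by (simp add: L2_def)
  have "integrable (lebesgue_on B) (\<lambda>x. (norm (K x + c))\<^sup>2)"
  proof -
    \<comment> \<open>This is the expanded square of \<open>norm (K x + c)\<close>; its linear term
      is integrable because the region has finite measure.\<close>
    have "integrable (lebesgue_on B) (\<lambda>x. (norm (K x))\<^sup>2 + 2 * (K x \<bullet> c) + (norm c)\<^sup>2)"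
      using K L2_integrable_inner[OF K, of c]
        finite_measure.integrable_const[OF finite_measure_region, of "(norm c)\<^sup>2"]
      by (intro Bochner_Integration.integrable_add integrable_mult_right) (auto simp: L2_def)
    then show ?thesis
      by (simp add: power2_norm_eq_inner inner_add inner_commute algebra_simps)
  qed
  then have "(\<lambda>x. K x + c) \<in> L2 (lebesgue_on B)"
    using m by (simp add: L2_def)
  then show ?thesis
    using assms is_weak_curl2_add_const[OF K] is_weak_curl3_add_const[OF K]
    unfolding Hc_def by (cases "CARD('n) = 2") (simp_all, blast+)
qed

lemma zero_Hc: "0 \<in> Hc ix B"
proof -
  have "is_weak_curl2 ix B 0 0" "is_weak_curl3 ix B 0 0"
    by (simp_all add: is_weak_curl2_def is_weak_curl3_def)
  then show ?thesis by (auto simp: Hc_def intro: L2_zero bexI[OF _ L2_zero])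
qed

lemma const_Hc: "(\<lambda>_. c) \<in> Hc ix B"
  using Hc_add_const[OF zero_Hc, of c ix] by simp

text \<open>Zero is a weak curl of a constant, so only the square-integral part of the norm
  survives. Outside dimension 2 the dimension is 3, and \<open>ix\<close> numbers all coordinates by
  1 to 3.\<close>

lemma Hc_norm_const:
  assumes "bij_betw ix {1..CARD('n)} (UNIV :: 'n set)" "CARD('n) \<in> {2, 3}"
  shows "Hc_norm ix B (\<lambda>_. c) = sqrt (measure lebesgue B) * norm c"
proof -
  have z: "is_weak_curl2 ix B (\<lambda>_. c) (\<lambda>_. 0)" "is_weak_curl3 ix B (\<lambda>_. c) (\<lambda>_. 0)"
    using is_weak_curl2_add_const[OF L2_zero, of ix "\<lambda>_. 0" c]
      is_weak_curl3_add_const[OF L2_zero, of ix "\<lambda>_. 0" c]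
    by (simp_all add: is_weak_curl2_def is_weak_curl3_def)
  have "L2_inner (lebesgue_on B) (wcurl2 ix B (\<lambda>_. c)) (wcurl2 ix B (\<lambda>_. c))
      = L2_inner (lebesgue_on B) (\<lambda>_. 0) (\<lambda>_. 0 :: real^'n)"
    by (intro L2_inner_cong_AE wcurl2_AE_eq[OF L2_const z(1)] L2_const)
  moreover have "L2_inner (lebesgue_on B) (wcurl3 ix B (\<lambda>_. c)) (wcurl3 ix B (\<lambda>_. c))
      = L2_inner (lebesgue_on B) (\<lambda>_. 0) (\<lambda>_. 0 :: real^'n^'n)" if "CARD('n) \<noteq> 2"
  proof -
    have "ix ` {1..3} = UNIV" using assms that by (auto simp: bij_betw_def)
    note * = wcurl3_AE_eq[OF this L2_const z(2)]
    show ?thesis by (intro L2_inner_cong_AE * L2_const)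
  qed
  ultimately show ?thesis
    by (simp add: Hc_norm_def L2_inner_const real_sqrt_mult norm_eq_sqrt_inner)
qed

lemma zero_Hd: "0 \<in> Hd B" and Hd_norm_zero: "Hd_norm B 0 = 0"
proof -
  have z: "is_weak_div B 0 (\<lambda>_. 0)" by (simp add: is_weak_div_def)
  then show "0 \<in> Hd B" by (auto simp: Hd_def intro: L2_zero L2_const)
  have "L2_inner (lebesgue_on B) (wdiv B 0) (wdiv B 0)
      = L2_inner (lebesgue_on B) (\<lambda>_. 0) (\<lambda>_. 0 :: real^'n)"
    by (intro L2_inner_cong_AE wdiv_AE_eq[OF L2_const z] L2_const)
  then show "Hd_norm B 0 = 0" by (simp add: Hd_norm_def L2_inner_const)
qed

end

section \<open>Directional derivatives and the theorem\<close>

text \<open>Along the line through \<open>u\<close> the seminorm of the increment is at most a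
  multiple of the modulus of \<open>t\<close>, so the Frechet remainder becomes \<open>o(t)\<close>.
  The linear bound is requested for this one direction, where it can be computed.\<close>

lemma has_frechet_deriv_directional:
  assumes f: "has_frechet_deriv V nV UNIV abs f D u"
    and v: "\<And>t. t *\<^sub>R v \<in> V" "\<And>t. nV (t *\<^sub>R v) \<le> \<bar>t\<bar> * N"
  shows "((\<lambda>t. f (u + t *\<^sub>R v)) has_real_derivative D v) (at 0)"
proof -
  have vV: "v \<in> V" using v(1)[of 1] by simp
  have D: "D (t *\<^sub>R v) = t * D v" for t
  proof -
    \<comment> \<open>Linearity holds up to null vectors of the target seminorm; for
      \<open>abs\<close> on the reals this is equality.\<close>
    have "\<bar>D (t *\<^sub>R v + 0 *\<^sub>R v) - (t *\<^sub>R D v + 0 *\<^sub>R D v)\<bar> = 0"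
      using f vV unfolding has_frechet_deriv_def by blast
    then show ?thesis by simp
  qed
  \<comment> \<open>A strictly positive bound, so that it can be divided by.\<close>
  define N' where "N' = \<bar>N\<bar> + 1"
  have N': "N' > 0" "nV (t *\<^sub>R v) \<le> \<bar>t\<bar> * N'" for t
  proof -
    have "\<bar>t\<bar> * N \<le> \<bar>t\<bar> * N'" by (intro mult_left_mono) (auto simp: N'_def)
    then show "nV (t *\<^sub>R v) \<le> \<bar>t\<bar> * N'" using v(2)[of t] by linarith
  qed (simp add: N'_def)
  show ?thesis
    unfolding DERIV_def
  proof (rule LIM_I)
    fix r :: real assume r: "r > 0"
    \<comment> \<open>This tolerance makes the remainder at most half of \<open>r\<close> times the
      modulus of \<open>t\<close>; the spare factor 2 yields the strict inequality.\<close>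
    then have "r / (2 * N') > 0" using N' by simp
    then obtain \<delta> where \<delta>: "\<delta> > 0"
      and est: "\<And>h. h \<in> V \<Longrightarrow> nV h < \<delta> \<Longrightarrow> \<bar>f (u + h) - f u - D h\<bar> \<le> r / (2 * N') * nV h"
      using f unfolding has_frechet_deriv_def by metis
    show "\<exists>s>0. \<forall>t. t \<noteq> 0 \<and> norm (t - 0) < s \<longrightarrow>
      norm ((f (u + (0 + t) *\<^sub>R v) - f (u + 0 *\<^sub>R v)) / t - D v) < r"
    proof (intro exI[of _ "\<delta> / N'"] conjI allI impI)
      show "\<delta> / N' > 0" using \<delta> N' by simp
      fix t :: real assume t: "t \<noteq> 0 \<and> norm (t - 0) < \<delta> / N'"
      then have "\<bar>t\<bar> * N' < \<delta>" using N'(1) by (simp add: field_simps)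
      then have "nV (t *\<^sub>R v) < \<delta>" using N'(2)[of t] by linarith
      from est[OF v(1) this] have "\<bar>f (u + t *\<^sub>R v) - f u - t * D v\<bar> \<le> r / (2 * N') * nV (t *\<^sub>R v)"
        by (simp add: D)
      also have "\<dots> \<le> r / (2 * N') * (\<bar>t\<bar> * N')"
        using r N' by (intro mult_left_mono) auto
      also have "\<dots> = r / 2 * \<bar>t\<bar>" using N' by simp
      also have "\<dots> < r * \<bar>t\<bar>" using r t by simp
      finally have *: "\<bar>f (u + t *\<^sub>R v) - f u - t * D v\<bar> < r * \<bar>t\<bar>" .
      have "(f (u + t *\<^sub>R v) - f u) / t - D v = (f (u + t *\<^sub>R v) - f u - t * D v) / t"
        using t by (simp add: field_simps)
      then show "norm ((f (u + (0 + t) *\<^sub>R v) - f (u + 0 *\<^sub>R v)) / t - D v) < r"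
        using * t by (simp add: abs_divide divide_less_eq)
    qed
  qed
qed

theorem mainTheorem1:
  fixes B \<Gamma>\<^sub>1 \<Gamma>\<^sub>2 :: "(real^'n) set"
    and ix :: "nat \<Rightarrow> 'n"
    and R :: "real^'n \<Rightarrow> real^'n^'n \<Rightarrow> real^'n^'n"
    and A :: "real^'n \<Rightarrow> real^'n^'n \<Rightarrow> real^'n^'n^'n^'n"
    and \<O> :: "(real^'n \<Rightarrow> real^'n^'n) set"
    and bf Tbar :: "real^'n \<Rightarrow> real^'n"
  assumes dim: "CARD('n) \<in> {2, 3}"
    and ix: "bij_betw ix {1..CARD('n)} UNIV"
    and B: "lipschitz_domain B"
    and \<Gamma>_cover: "\<Gamma>\<^sub>1 \<union> \<Gamma>\<^sub>2 = frontier B"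
    and \<Gamma>_disjoint: "(top_of_set (frontier B) interior_of \<Gamma>\<^sub>1)
                       \<inter> (top_of_set (frontier B) interior_of \<Gamma>\<^sub>2) = {}"
    and \<Gamma>_meas: "\<Gamma>\<^sub>1 \<in> sets surface_measure" "\<Gamma>\<^sub>2 \<in> sets surface_measure"
    and bf: "bf \<in> L2 (lebesgue_on B)"
    and Tbar: "Tbar \<in> L2 (surface_on \<Gamma>\<^sub>2)"
    and \<O>_open: "seminorm_open (Hc ix B) (Hc_norm ix B) \<O>"
    and \<O>_nonempty: "\<O> \<noteq> {}"
    and response_L2: "\<forall>K\<in>\<O>. response R K \<in> L2 (lebesgue_on B)"
    and response_deriv: "\<forall>K\<in>\<O>. has_frechet_deriv (Hc ix B) (Hc_norm ix B)
           (L2 (lebesgue_on B)) (L2_norm (lebesgue_on B))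
           (response R) (\<lambda>M X. ddot (A X (K X)) (M X)) K"
  shows "\<not> (\<exists>J :: 'n state \<Rightarrow> real. Z_functional ix B J \<and>
           (\<forall>U K P. (U, K, P) \<in> Z_space ix B \<and> K \<in> \<O> \<longrightarrow>
              (\<exists>D. has_frechet_deriv (Z_space ix B) (Z_norm ix B) UNIV abs J D (U, K, P) \<and>
                   (\<forall>v\<in>Z_space ix B. D v = G_form B \<Gamma>\<^sub>2 R bf Tbar (U, K, P) v))))"
proof
  assume "\<exists>J :: 'n state \<Rightarrow> real. Z_functional ix B J \<and>
           (\<forall>U K P. (U, K, P) \<in> Z_space ix B \<and> K \<in> \<O> \<longrightarrow>
              (\<exists>D. has_frechet_deriv (Z_space ix B) (Z_norm ix B) UNIV abs J D (U, K, P) \<and>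
                   (\<forall>v\<in>Z_space ix B. D v = G_form B \<Gamma>\<^sub>2 R bf Tbar (U, K, P) v)))"
  then obtain J :: "'n state \<Rightarrow> real" where
    J: "\<And>U K P. (U, K, P) \<in> Z_space ix B \<Longrightarrow> K \<in> \<O> \<Longrightarrow>
      \<exists>D. has_frechet_deriv (Z_space ix B) (Z_norm ix B) UNIV abs J D (U, K, P) \<and>
          (\<forall>v\<in>Z_space ix B. D v = G_form B \<Gamma>\<^sub>2 R bf Tbar (U, K, P) v)"
    by blast
  have oB: "open B" and bB: "bounded B" and "B \<noteq> {}"
    using B by (auto simp: lipschitz_domain_def)
  note region = oB bB
  let ?G = "G_form B \<Gamma>\<^sub>2 R bf Tbar"
  let ?M = "lebesgue_on B"
  define X :: "'n vfield" where "X = (\<lambda>x. x)"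
  define E :: "'n tfield" where "E = (\<lambda>_. mat 1)"
  have tX: "t *\<^sub>R X = (\<lambda>x. t *\<^sub>R x)" and tE: "t *\<^sub>R E = (\<lambda>_. t *\<^sub>R mat 1)" for t
    by (simp_all add: X_def E_def scaleR_fun_def)
  \<comment> \<open>All directions used lie in the plane spanned by \<open>(X, 0, 0)\<close> and
    \<open>(0, E, 0)\<close>. The stress stays 0, which removes the terms of \<open>G\<close>
    containing \<open>P\<close> or the response.\<close>
  have dir: "((\<lambda>t. J ((U, K, 0) + t *\<^sub>R (a *\<^sub>R X, b *\<^sub>R E, 0))) has_real_derivative
      ?G (U, K, 0) (a *\<^sub>R X, b *\<^sub>R E, 0)) (at 0)"
    if "U \<in> H1 B" "K \<in> Hc ix B" "K \<in> \<O>" for U K a b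
  proof -
    have v: "t *\<^sub>R (a *\<^sub>R X, b *\<^sub>R E, 0)
        = (\<lambda>x. (t * a) *\<^sub>R x, \<lambda>_. (t * b) *\<^sub>R mat 1, 0 :: 'n tfield)" for t
      by (simp add: X_def E_def scaleR_fun_def zero_fun_def)
    have Z: "t *\<^sub>R (a *\<^sub>R X, b *\<^sub>R E, 0) \<in> Z_space ix B" for t
      unfolding v Z_space_def
      by (intro SigmaI scaled_ident_H1[OF region] const_Hc[OF region] zero_Hd[OF region])
    have UKP: "(U, K, 0) \<in> Z_space ix B"
      unfolding Z_space_def using that zero_Hd[OF region] by blast
    obtain D where D: "has_frechet_deriv (Z_space ix B) (Z_norm ix B) UNIV abs J D (U, K, 0)"
      and DG: "\<And>v. v \<in> Z_space ix B \<Longrightarrow> D v = ?G (U, K, 0) v"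
      using J[OF UKP \<open>K \<in> \<O>\<close>] by blast
    \<comment> \<open>On this plane the norm is computed exactly and is homogeneous, which supplies
      the bound for the directional derivative.\<close>
    have "Z_norm ix B (t *\<^sub>R (a *\<^sub>R X, b *\<^sub>R E, 0))
        \<le> \<bar>t\<bar> * sqrt ((\<bar>a\<bar> * H1_norm B (\<lambda>x. x))\<^sup>2
            + (\<bar>b\<bar> * (sqrt (measure lebesgue B) * norm (mat 1 :: real^'n^'n)))\<^sup>2)" for t
    proof -
      have "Z_norm ix B (t *\<^sub>R (a *\<^sub>R X, b *\<^sub>R E, 0))
          = sqrt (t\<^sup>2 * ((\<bar>a\<bar> * H1_norm B (\<lambda>x. x))\<^sup>2
            + (\<bar>b\<bar> * (sqrt (measure lebesgue B) * norm (mat 1 :: real^'n^'n)))\<^sup>2))"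
        unfolding Z_norm_def v
        by (simp add: abs_mult H1_norm_scaled_ident[OF region] Hc_norm_const[OF region ix dim]
            Hd_norm_zero[OF region] power_mult_distrib distrib_left)
      then show ?thesis by (simp add: real_sqrt_mult)
    qed
    from has_frechet_deriv_directional[OF D Z this]
    show ?thesis using DG[OF Z[of 1]] by (simp only: scaleR_one)
  qed
  obtain K\<^sub>0 where K\<^sub>0: "K\<^sub>0 \<in> \<O>" using \<O>_nonempty by blast
  then have K\<^sub>0_Hc: "K\<^sub>0 \<in> Hc ix B" using \<O>_open by (auto simp: seminorm_open_def)
  define K where "K t = K\<^sub>0 + t *\<^sub>R E" for t
  have K_Hc: "K t \<in> Hc ix B" for t
    using Hc_add_const[OF region K\<^sub>0_Hc, of "t *\<^sub>R mat 1"] by (simp add: K_def tE plus_fun_def)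
  obtain \<delta> where \<delta>: "\<delta> > 0" and K_O: "\<And>t. \<bar>t\<bar> < \<delta> \<Longrightarrow> K t \<in> \<O>"
  proof -
    obtain e where e: "e > 0" "\<And>v. v \<in> Hc ix B \<Longrightarrow> Hc_norm ix B (v - K\<^sub>0) < e \<Longrightarrow> v \<in> \<O>"
      using \<O>_open K\<^sub>0 unfolding seminorm_open_def by metis
    \<comment> \<open>\<open>N - 1\<close> is the curl-space norm of \<open>E\<close>; the extra 1
      makes \<open>e / N\<close> meaningful.\<close>
    define N where "N = sqrt (measure lebesgue B) * norm (mat 1 :: real^'n^'n) + 1"
    have N: "N > 0" unfolding N_def by (intro add_nonneg_pos) auto
    show thesis
    proof
      show "e / N > 0" using e N by simp
      fix t assume "\<bar>t\<bar> < e / N"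
      then have "\<bar>t\<bar> * N < e" using N by (simp add: field_simps)
      moreover have "Hc_norm ix B (K t - K\<^sub>0) = \<bar>t\<bar> * (N - 1)"
        by (simp add: K_def tE Hc_norm_const[OF region ix dim] N_def)
      ultimately have "Hc_norm ix B (K t - K\<^sub>0) < e" by (simp add: right_diff_distrib)
      then show "K t \<in> \<O>" by (rule e(2)[OF K_Hc])
    qed
  qed
  (* For P = 0, G ((U, K, P), (X, 0, 0)) does not depend on U and K. *)
  define c where "c = ?G (0, K\<^sub>0, 0) (X, 0, 0)"
  have c: "J (X, K t, 0) - J (0, K t, 0) = c" if t: "\<bar>t\<bar> < \<delta>" for t
  proof -
    have "((\<lambda>s. J (s *\<^sub>R X, K t, 0)) has_real_derivative c) (at s)" for s
    proof -
      \<comment> \<open>\<open>dir\<close> differentiates at parameter 0 only. Taking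
        \<open>s X\<close> as base point and shifting the parameter gives the derivative at every
        \<open>s\<close>.\<close>
      have "((\<lambda>h. J ((s *\<^sub>R X, K t, 0) + h *\<^sub>R (1 *\<^sub>R X, 0 *\<^sub>R E, 0))) has_real_derivative
          ?G (s *\<^sub>R X, K t, 0) (1 *\<^sub>R X, 0 *\<^sub>R E, 0)) (at 0)"
        by (intro dir K_Hc K_O t) (simp add: tX scaled_ident_H1[OF region])
      moreover have "?G (s *\<^sub>R X, K t, 0) (1 *\<^sub>R X, 0 *\<^sub>R E, 0) = c"
        by (simp add: G_form_def c_def)
      ultimately have "((\<lambda>h. J ((h + s) *\<^sub>R X, K t, 0)) has_real_derivative c) (at 0)"
        by (simp add: scaleR_left_distrib add.commute)
      then show ?thesis using DERIV_shift[of "\<lambda>s. J (s *\<^sub>R X, K t, 0)" c 0 s] by simp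
    qed
    from MVT2[OF zero_less_one this] show ?thesis by auto
  qed
  have deriv: "((\<lambda>t. J (s *\<^sub>R X, K t, 0)) has_real_derivative ?G (s *\<^sub>R X, K\<^sub>0, 0) (0, E, 0)) (at 0)"
    for s
    using dir[of "s *\<^sub>R X" "K\<^sub>0" 0 1] K\<^sub>0 K\<^sub>0_Hc scaled_ident_H1[OF region, of s]
    by (simp add: tX[of s, symmetric] K_def)
  \<comment> \<open>Subtracting the cases \<open>s = 1\<close> and \<open>s = 0\<close> cancels the
    terms of \<open>G\<close> independent of \<open>U\<close>. The traction term with the chosen
    trace of the zero field disappears without being evaluated.\<close>
  have "((\<lambda>t. J (1 *\<^sub>R X, K t, 0) - J (0 *\<^sub>R X, K t, 0)) has_real_derivative
      ?G (1 *\<^sub>R X, K\<^sub>0, 0) (0, E, 0) - ?G (0 *\<^sub>R X, K\<^sub>0, 0) (0, E, 0)) (at 0)"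
    by (intro DERIV_diff deriv)
  \<comment> \<open>Near 0 the increment in the direction \<open>X\<close> is the constant
    \<open>c\<close>, so the mixed second-order change must vanish.\<close>
  moreover have "((\<lambda>t. J (1 *\<^sub>R X, K t, 0) - J (0 *\<^sub>R X, K t, 0)) has_real_derivative 0) (at 0)"
    by (rule has_field_derivative_transform_within_open[of "\<lambda>_. c" _ _ "ball 0 \<delta>"])
      (use \<delta> c in auto)
  ultimately have eq: "?G (1 *\<^sub>R X, K\<^sub>0, 0) (0, E, 0) - ?G (0 *\<^sub>R X, K\<^sub>0, 0) (0, E, 0) = 0"
    by (rule DERIV_unique)
  \<comment> \<open>The case \<open>s = 0\<close> is included because even the weak gradient of the
    zero field is a chosen representative.\<close>
  have "L2_inner ?M (wgrad B (s *\<^sub>R X)) E = s * (measure lebesgue B * (mat 1 \<bullet> (mat 1 :: real^'n^'n)))"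
    for s
  proof -
    have "L2_inner ?M (wgrad B (s *\<^sub>R X)) E = L2_inner ?M (\<lambda>_. s *\<^sub>R mat 1) E"
      unfolding tX E_def
      by (intro L2_inner_cong_AE wgrad_scaled_ident[OF region] L2_const[OF region]) simp
    then show ?thesis by (simp add: E_def L2_inner_const[OF region])
  qed
  from this[of 1] this[of 0] eq
  have "measure lebesgue B * (mat 1 \<bullet> (mat 1 :: real^'n^'n)) = 0"
    by (simp add: G_form_def)
  \<comment> \<open>A nonempty open set is not negligible. Boundedness makes its measure finite, so
    that the real-valued \<open>measure\<close> detects this.\<close>
  moreover have "measure lebesgue B \<noteq> 0"
    using region \<open>B \<noteq> {}\<close> open_not_negligible negligible_iff_measure0 lmeasurable_open by blast
  moreover have "(mat 1 :: real^'n^'n) \<noteq> 0"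
    by (simp add: mat_def vec_eq_iff)
  ultimately show False by simp
qed

end
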